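(* Let $f\colon[0,1]\to[0,1]$ be a Manneville--Pomeau type map with branch point $r_1$ and let $F\colon[r_1,1]\to[r_1,1]$ be its induced first return map (as defined in the context). For every countable set $Q\subset[r_1,1]$, the exceptional set $$\mathcal E_F(Q)=\big\{x\in[r_1,1]\colon Q\cap\overline{\{F^n(x)\colon n\ge 0\}}=\emptyset\big\}$$ is absolute winning in $[r_1,1]$.
   Context: **Manneville--Pomeau type map.** A two-branch interval map $f\colon[0,1]\to[0,1]$ for which there is $r_1\in(0,1)$ such that (using one-sided derivatives, i.e. derivatives of the one-sided branch extensions, as needed): (1) $f((0,r_1))=f((r_1,1))=(0,1)$; (2) $f$ is $C^1$ on $[0,r_1)$ and $C^2$ on $(0,r_1)\cup(r_1,1]$; (3) $f(0)=f(r_1)=0$, $f'(0)=1$, and $|f'|>1$ on $(0,1]$ (hence $\inf_{x\in[\epsilon,1]}|f'|>1$ for all $\epsilon>0$); (4) $\sup_{x\in[0,1]}|f'(x)|<\infty$ and $\sup_{x\in(r_1,1]}|f''(x)|<\infty$; (5) there exist $C\ge1$ and $\gamma>0$ such that $C^{-1}\le f''(x)/x^{\gamma-1}\le C$ for $x\in(0,r_1)$. The branch of $f$ on $(r_1,1]$ is monotone and may have either orientation. The value $f(r_1)=0$ is a convention. **Induced map.** Let $\tau(x)=\inf\{n\ge1\colon f^n(x)\in[r_1,1]\}$, with $\inf\emptyset=\infty$. Define $F\colon[r_1,1]\to[r_1,1]$ by $F(x)=f^{\tau(x)}(x)$ whenever $\tau(x)<\infty$, and assign $F(x)\in\{r_1,1\}$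 arbitrarily when $\tau(x)=\infty$. **Absolute game.** Let $I\subset\mathbb R$ be a nontrivial compact interval, $S\subset I$, and $0<\beta<1/3$. In the $\beta$-absolute game Bob chooses a nontrivial closed interval $B_1\subset I$. After Bob chooses $B_n$, Alice deletes a closed interval $A_n\subset B_n$ with $|A_n|\le\beta|B_n|$. Bob then chooses a closed interval $B_{n+1}\subset B_n\setminus A_n$ with $|B_{n+1}|\ge\beta|B_n|$. Alice wins if $\bigcap_n B_n$ meets $S$. The set $S$ is $\beta$-absolute winning in $I$ if Alice can win regardless of Bob's choices, and absolute winning in $I$ if it is $\beta$-absolute winning for every $0<\beta<1/3$. Here $|\cdot|$ denotes length. *)

theory Defs
  imports "HOL-Analysis.Analysis" "HOL-Library.Extended_Nat"
begin

section \<open>Manneville--Pomeau type maps\<close>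

text \<open>Derivatives relative to a set: one-sided at the endpoints that belong to \<open>S\<close>.\<close>

definition deriv_on :: "real set \<Rightarrow> (real \<Rightarrow> real) \<Rightarrow> real \<Rightarrow> real" where
  "deriv_on S g x = vector_derivative g (at x within S)"

definition C1_on :: "real set \<Rightarrow> (real \<Rightarrow> real) \<Rightarrow> bool" where
  "C1_on S g \<longleftrightarrow> (\<forall>x\<in>S. g differentiable (at x within S)) \<and> continuous_on S (deriv_on S g)"

definition C2_on :: "real set \<Rightarrow> (real \<Rightarrow> real) \<Rightarrow> bool" where
  "C2_on S g \<longleftrightarrow> C1_on S g \<and> C1_on S (deriv_on S g)"

text \<open>
  The branches of \<open>f\<close>, extended continuously to the branch point. The value \<open>f r\<close> is not used:
  it is only a convention, and for a decreasing second branch it differs from the right limit.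
\<close>

definition left_branch :: "(real \<Rightarrow> real) \<Rightarrow> real \<Rightarrow> real \<Rightarrow> real" where
  "left_branch f r x = (if x < r then f x else Lim (at_left r) f)"

definition right_branch :: "(real \<Rightarrow> real) \<Rightarrow> real \<Rightarrow> real \<Rightarrow> real" where
  "right_branch f r x = (if x > r then f x else Lim (at_right r) f)"

text \<open>
  At \<open>r\<close>, the conditions on \<open>f'\<close> are imposed on the one-sided derivatives of both branch
  extensions; this is what makes \<open>\<bar>f'\<bar>\<close> bounded away from \<open>1\<close> on \<open>{\<epsilon>..1}\<close>. That these
  derivatives exist already follows from the bounds on \<open>f''\<close>.
\<close>

definition manneville_pomeau :: "(real \<Rightarrow> real) \<Rightarrow> real \<Rightarrow> bool" where
  "manneville_pomeau f r \<longleftrightarrow>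
     0 < r \<and> r < 1 \<and> f ` {0..1} \<subseteq> {0..1} \<and>
     f ` {0<..<r} = {0<..<1} \<and> f ` {r<..<1} = {0<..<1} \<and>
     C1_on {0..<r} f \<and> C2_on {0<..<r} f \<and> C2_on {r<..1} f \<and>
     left_branch f r differentiable (at r within {0..r}) \<and>
     right_branch f r differentiable (at r within {r..1}) \<and>
     f 0 = 0 \<and> f r = 0 \<and> deriv_on {0..<r} f 0 = 1 \<and>
     (\<forall>x\<in>{0<..r}. 1 < \<bar>deriv_on {0..r} (left_branch f r) x\<bar>) \<and>
     (\<forall>x\<in>{r..1}. 1 < \<bar>deriv_on {r..1} (right_branch f r) x\<bar>) \<and>
     bdd_above ((\<lambda>x. \<bar>deriv_on {0..r} (left_branch f r) x\<bar>) ` {0..r}) \<and>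
     bdd_above ((\<lambda>x. \<bar>deriv_on {r..1} (right_branch f r) x\<bar>) ` {r..1}) \<and>
     bdd_above ((\<lambda>x. \<bar>deriv_on {r<..1} (deriv_on {r<..1} f) x\<bar>) ` {r<..1}) \<and>
     (\<exists>C \<gamma>. 1 \<le> C \<and> 0 < \<gamma> \<and>
        (\<forall>x\<in>{0<..<r}.
           inverse C \<le> deriv_on {0<..<r} (deriv_on {0<..<r} f) x / x powr (\<gamma> - 1) \<and>
           deriv_on {0<..<r} (deriv_on {0<..<r} f) x / x powr (\<gamma> - 1) \<le> C))"


section \<open>Induced map and exceptional set\<close>

definition return_time :: "(real \<Rightarrow> real) \<Rightarrow> real \<Rightarrow> real \<Rightarrow> enat" where
  "return_time f r x = Inf {enat n | n. 1 \<le> n \<and> (f ^^ n) x \<in> {r..1}}"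

text \<open>A predicate, not a function, since the value at infinite return time is an arbitrary choice.\<close>

definition induced_map :: "(real \<Rightarrow> real) \<Rightarrow> real \<Rightarrow> (real \<Rightarrow> real) \<Rightarrow> bool" where
  "induced_map f r F \<longleftrightarrow>
     (\<forall>x\<in>{r..1}. case return_time f r x of
        enat n \<Rightarrow> F x = (f ^^ n) x
      | \<infinity> \<Rightarrow> F x \<in> {r, 1})"

definition exceptional_set :: "'a::topological_space set \<Rightarrow> ('a \<Rightarrow> 'a) \<Rightarrow> 'a set \<Rightarrow> 'a set" where
  "exceptional_set X F Q = {x \<in> X. Q \<inter> closure {(F ^^ n) x | n. n \<ge> 0} = {}}"


section \<open>The absolute game\<close>

text \<open>Closed intervals are given by their endpoints.\<close>

type_synonym interval = "real \<times> real"

definition ivl :: "interval \<Rightarrow> real set" where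
  "ivl J = {fst J..snd J}"

definition len :: "interval \<Rightarrow> real" where
  "len J = snd J - fst J"

text \<open>
  Rounds are numbered from \<open>0\<close>. A strategy \<open>\<sigma>\<close> of Alice maps the list of Bob's moves so far,
  oldest first, to the interval she deletes.
\<close>

definition alice_move :: "(interval list \<Rightarrow> interval) \<Rightarrow> (nat \<Rightarrow> interval) \<Rightarrow> nat \<Rightarrow> interval" where
  "alice_move \<sigma> B n = \<sigma> (map B [0..<Suc n])"

text \<open>Bob's moves \<open>B 0, \<dots>, B n\<close> obey the rules against the strategy \<open>\<sigma>\<close>.\<close>

definition bob_legal ::
  "real \<Rightarrow> real set \<Rightarrow> (interval list \<Rightarrow> interval) \<Rightarrow> (nat \<Rightarrow> interval) \<Rightarrow> nat \<Rightarrow> bool" where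
  "bob_legal \<beta> I \<sigma> B n \<longleftrightarrow>
     fst (B 0) < snd (B 0) \<and> ivl (B 0) \<subseteq> I \<and>
     (\<forall>k<n. fst (B (Suc k)) \<le> snd (B (Suc k)) \<and>
            ivl (B (Suc k)) \<subseteq> ivl (B k) - ivl (alice_move \<sigma> B k) \<and>
            len (B (Suc k)) \<ge> \<beta> * len (B k))"

definition alice_legal :: "real \<Rightarrow> interval \<Rightarrow> interval \<Rightarrow> bool" where
  "alice_legal \<beta> B A \<longleftrightarrow> fst A \<le> snd A \<and> ivl A \<subseteq> ivl B \<and> len A \<le> \<beta> * len B"

definition beta_absolute_winning :: "real \<Rightarrow> real set \<Rightarrow> real set \<Rightarrow> bool" where
  "beta_absolute_winning \<beta> I S \<longleftrightarrow>
     (\<exists>\<sigma>. (\<forall>B n. bob_legal \<beta> I \<sigma> B n \<longrightarrow> alice_legal \<beta> (B n) (alice_move \<sigma> B n)) \<and>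
          (\<forall>B. (\<forall>n. bob_legal \<beta> I \<sigma> B n) \<longrightarrow> (\<Inter>n. ivl (B n)) \<inter> S \<noteq> {}))"

definition absolute_winning :: "real set \<Rightarrow> real set \<Rightarrow> bool" where
  "absolute_winning I S \<longleftrightarrow>
     (\<exists>a b. a < b \<and> I = {a..b}) \<and> S \<subseteq> I \<and>
     (\<forall>\<beta>. 0 < \<beta> \<and> \<beta> < 1/3 \<longrightarrow> beta_absolute_winning \<beta> I S)"

end

theory Submission
  imports Defs
begin

text \<open>
  Let \<open>g\<^sub>i\<close> be the inverse branches of the induced map \<open>F\<close>: they contract \<open>[r, 1]\<close> uniformly, and for a word
  \<open>w\<close> the composition \<open>g\<^sub>w\<close> maps \<open>[r, 1]\<close> onto a cylinder. The orbit of \<open>x\<close> comes within \<open>\<delta>\<close> of \<open>q\<close>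
  exactly when \<open>x\<close> lies in one of the sets \<open>g\<^sub>w (q - \<delta>, q + \<delta>)\<close>, apart from the points whose orbit hits
  \<open>r\<close> or \<open>1\<close>; these are handled by adding \<open>r\<close> and \<open>1\<close> to the countable set. So Alice has to avoid
  a countable family of obstacles, one for each word \<open>w\<close> and each point \<open>q\<^sub>j\<close>. Three facts make this possible.

  \<^item> \<^emph>\<open>Obstacles are small.\<close> The \<open>g\<^sub>w\<close> have uniformly bounded distortion
    (\<open>word'_bounded_distortion\<close>), so an obstacle occupies a proportion of its cylinder that tends to
    \<open>0\<close> with \<open>\<delta>\<close>, uniformly in \<open>w\<close> (\<open>word_proportion\<close>).
  \<^item> \<^emph>\<open>Obstacles are sparse.\<close> An interval meets only a bounded number of cylinders of size comparable with
    its own (\<open>cylinders_sparse\<close>): cylinders through one point form a chain whose sizes decay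
    geometrically, and a long cylinder that meets the interval covers a point of a fixed finite grid. Hence the
    infinite number of branches does no harm.
  \<^item> \<^emph>\<open>Alice can pay for several obstacles with one move.\<close> An obstacle is active once Bob's interval \<open>B\<close> is
    no longer than its cylinder. Alice's potential is the sum of \<open>d\<^sup>c\<close> over the active obstacles that meet \<open>B\<close>,
    where \<open>d\<close> bounds the diameter and \<open>c > 0\<close> is small. Cut \<open>B\<close> into boundedly many pieces and delete a
    neighbourhood of the piece with the largest potential: the potential drops by a fixed factor
    \<open>\<theta> < 1\<close>. Compared with \<open>\<bar>B\<bar>\<^sup>c\<close> it grows by at most \<open>\<beta>\<^sup>-\<^sup>2\<^sup>c\<close> while Bob shrinks his interval,
    and \<open>c\<close> is chosen such that the product is less than \<open>1\<close>. As newly activated obstacles contribute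
    little, the potential stays below a small multiple of \<open>\<bar>B\<bar>\<^sup>c\<close>, and no obstacle can
    meet all of Bob's intervals (\<open>beta_absolute_winning_if_sparse_obstacles\<close>). One strategy serves all the
    points \<open>q\<^sub>j\<close> together, because the weights of the \<open>j\<close>-th family carry a factor \<open>2\<^sup>-\<^sup>j\<^sup>c\<close>.

  The distortion bound is where the neutral fixed point matters (\<open>iter_deriv_distortion\<close>). On the left branch
  \<open>f'\<close> is increasing and bounded, so its increments over the successive fundamental intervals
  \<open>[h\<^sup>i\<^sup>+\<^sup>1 1, h\<^sup>i 1]\<close>, where \<open>h\<close> is the inverse of the left branch, have a telescoping, finite sum. The growth
  condition on \<open>f''\<close> makes it almost constant on each of them, so that this sum controls the distortion
  of all the iterates of \<open>h\<close> in a Lipschitz fashion.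
\<close>

section \<open>Total weight of a set of obstacles\<close>

text \<open>
  The weight is a measure with values in the extended reals, so that infinite sets of obstacles need no
  summability conditions.
\<close>

definition mass :: "('i \<Rightarrow> real) \<Rightarrow> 'i set \<Rightarrow> ennreal" where
  "mass v X = emeasure (point_measure UNIV (\<lambda>i. ennreal (v i))) X"

lemma mass_mono: "X \<subseteq> Y \<Longrightarrow> mass v X \<le> mass v Y"
  unfolding mass_def by (intro emeasure_mono) (auto simp: sets_point_measure)

lemma mass_finite: "finite X \<Longrightarrow> mass v X = (\<Sum>i\<in>X. ennreal (v i))"
  unfolding mass_def by (rule emeasure_point_measure_finite2) auto

lemma mass_Un_le: "mass v (X \<union> Y) \<le> mass v X + mass v Y"
  unfolding mass_def by (rule emeasure_subadditive) (auto simp: sets_point_measure)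

lemma mass_Un_disjoint: "X \<inter> Y = {} \<Longrightarrow> mass v (X \<union> Y) = mass v X + mass v Y"
  unfolding mass_def by (rule plus_emeasure[symmetric]) (auto simp: sets_point_measure)

lemma mass_UN_le: "finite K \<Longrightarrow> mass v (\<Union>k\<in>K. X k) \<le> (\<Sum>k\<in>K. mass v (X k))"
  unfolding mass_def by (rule emeasure_subadditive_finite) (auto simp: sets_point_measure)

lemma mass_UN_countable_le: "mass v (\<Union>k::nat. X k) \<le> (\<Sum>k. mass v (X k))"
  unfolding mass_def by (rule emeasure_subadditive_countably) (auto simp: sets_point_measure)

text \<open>
  If \<open>q\<close> is at least the \<open>N\<close>-th part of the total \<open>m\<close>, then taking it away leaves at most the proportion
  \<open>1 - 1 / N\<close>.
\<close>

lemma heavy_part_removed: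
  fixes p q m :: ennreal and N :: nat
  assumes "p + q \<le> m" "m \<le> of_nat N * q" "m < \<infinity>" "0 < N"
  shows "p \<le> ennreal (1 - 1 / N) * m"
proof -
  define p' q' m' where "p' = enn2real p" "q' = enn2real q" "m' = enn2real m"
  have "p \<le> m" "q \<le> m"
    using assms(1) by (metis add.commute add_increasing order_trans zero_le order_refl)+
  then have "p < top" "q < top" "m < top"
    using assms(3) by auto
  then have r: "p = ennreal p'" "q = ennreal q'" "m = ennreal m'" "0 \<le> p'" "0 \<le> q'" "0 \<le> m'"
    by (simp_all add: p'_q'_m'_def)
  have 1: "p' + q' \<le> m'"
    using assms(1) r by (simp flip: ennreal_plus)
  have 2: "m' \<le> N * q'"
    using assms(2) r by (simp add: ennreal_of_nat_eq_real_of_nat flip: ennreal_mult)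
  have "m' / N \<le> q'"
    using 2 assms(4) by (simp add: field_simps)
  then have "p' \<le> (1 - 1 / N) * m'"
    using 1 by (simp add: algebra_simps)
  moreover have "0 \<le> 1 - 1 / real N"
    using assms(4) by simp
  ultimately show ?thesis
    using r by (simp flip: ennreal_mult)
qed

section \<open>The potential strategy in the absolute game\<close>

text \<open>
  Here \<open>s i\<close> is the scale of the obstacle \<open>U i\<close>. It is ignored until Bob's interval is at most that long, because
  before that the obstacles in \<open>B\<close> may well be infinitely many with infinite total weight.
\<close>

definition active :: "('i \<Rightarrow> real set) \<Rightarrow> ('i \<Rightarrow> real) \<Rightarrow> interval \<Rightarrow> 'i set" where
  "active U s B = {i. len B \<le> s i \<and> U i \<inter> ivl B \<noteq> {}}"

lemma ivl_covered_by_pieces: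
  fixes N :: nat
  assumes "0 < N" "x \<in> ivl B"
  shows "\<exists>k<N. x \<in> {fst B + real k * (len B / N) .. fst B + (real k + 1) * (len B / N)}"
proof (cases "x = snd B")
  case True
  have "real N * (len B / N) = len B" "0 \<le> len B / N"
    using assms by (auto simp: len_def ivl_def)
  moreover from this have "real (N - 1) * (len B / N) \<le> len B"
    using mult_right_mono[of "real (N - 1)" "real N" "len B / N"] by simp
  ultimately have "x \<in> {fst B + real (N - 1) * (len B / N) .. fst B + (real (N - 1) + 1) * (len B / N)}"
    using True assms(1) by (simp add: len_def of_nat_diff)
  then show ?thesis using assms(1) by (intro exI[of _ "N - 1"]) simp
next
  case False
  then have x: "fst B \<le> x" "x < snd B" using assms(2) by (auto simp: ivl_def)
  define h where "h = len B / N"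
  have h: "h > 0" "N * h = len B" using x assms(1) by (auto simp: h_def len_def)
  define k where "k = nat \<lfloor>(x - fst B) / h\<rfloor>"
  have "0 \<le> (x - fst B) / h" using x h by simp
  then have k: "real k \<le> (x - fst B) / h" "(x - fst B) / h < real k + 1"
    unfolding k_def by linarith+
  have kh: "real k * h \<le> x - fst B" "x - fst B < (real k + 1) * h"
    using k h by (auto simp: field_simps)
  have "real k * h < real N * h" using kh h x by (simp add: len_def)
  then have "k < N" using h(1) by (metis mult_less_cancel_right_pos of_nat_less_iff)
  moreover have "x \<in> {fst B + real k * h .. fst B + (real k + 1) * h}"
    using kh by simp
  ultimately show ?thesis unfolding h_def by blast
qed

text \<open>
  Alice's basic move. Of \<open>N\<close> equal pieces of \<open>B\<close>, some piece is met by at least the \<open>N\<close>-th part of the active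
  weight. She deletes it together with a margin of \<open>\<beta> / 4\<close> times the length of \<open>B\<close> on both sides; as obstacles are
  not longer than the margin, those that meet the piece lie inside the deleted interval.
\<close>

lemma heavy_deletion:
  fixes U :: "'i \<Rightarrow> real set" and N :: nat and \<beta> :: real
  assumes "0 < \<beta>" "2 \<le> \<beta> * N" "fst B \<le> snd B"
  shows "\<exists>A. alice_legal \<beta> B A \<and>
    ((\<forall>i\<in>active U s B. \<forall>x\<in>U i. \<forall>y\<in>U i. \<bar>x - y\<bar> \<le> \<beta> / 4 * len B) \<longrightarrow>
     mass v (active U s B) < \<infinity> \<longrightarrow>
     (\<forall>B'. ivl B' \<subseteq> ivl B - ivl A \<longrightarrow>
        mass v {i\<in>active U s B. U i \<inter> ivl B' \<noteq> {}} \<le> ennreal (1 - 1 / N) * mass v (active U s B)))"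
proof -
  have N: "0 < N" using assms by (cases N) auto
  define l where "l = len B"
  have l: "0 \<le> l" using assms by (simp add: l_def len_def)
  define P where "P k = {fst B + real k * (l / N) .. fst B + (real k + 1) * (l / N)}" for k
  define H where "H k = {i\<in>active U s B. U i \<inter> P k \<noteq> {}}" for k
  have "Max ((\<lambda>k. mass v (H k)) ` {..<N}) \<in> (\<lambda>k. mass v (H k)) ` {..<N}"
    using N by (intro Max_in) auto
  then obtain k where k: "k < N" "mass v (H k) = Max ((\<lambda>k. mass v (H k)) ` {..<N})"
    by auto
  have kmax: "mass v (H k') \<le> mass v (H k)" if "k' < N" for k'
    unfolding k(2) using that by (intro Max_ge) auto
  have "active U s B \<subseteq> (\<Union>k<N. H k)"
  proof
    fix i assume i: "i \<in> active U s B"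
    then obtain x where x: "x \<in> U i" "x \<in> ivl B" by (auto simp: active_def)
    from ivl_covered_by_pieces[OF N x(2)] obtain k where "k < N" "x \<in> P k"
      by (auto simp: P_def l_def)
    with i x show "i \<in> (\<Union>k<N. H k)" by (auto simp: H_def)
  qed
  then have "mass v (active U s B) \<le> mass v (\<Union>k<N. H k)" by (rule mass_mono)
  also have "\<dots> \<le> (\<Sum>k<N. mass v (H k))" by (rule mass_UN_le) simp
  also have "\<dots> \<le> (\<Sum>k'<N. mass v (H k))" by (intro sum_mono kmax) simp
  also have "\<dots> = of_nat N * mass v (H k)" by simp
  finally have heavy: "mass v (active U s B) \<le> of_nat N * mass v (H k)" .
  define A where "A = (max (fst B) (fst B + real k * (l / N) - \<beta> / 4 * l),
                       min (snd B) (fst B + (real k + 1) * (l / N) + \<beta> / 4 * l))"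
  have lN: "l / N \<le> \<beta> / 2 * l"
  proof -
    have "l * 2 \<le> l * (\<beta> * N)" using assms(2) l by (rule mult_left_mono)
    then show ?thesis using N by (simp add: field_simps)
  qed
  have kN: "real k * (l / N) \<le> l"
  proof -
    have "real k * (l / N) \<le> real N * (l / N)" using k l by (intro mult_right_mono) auto
    then show ?thesis using N by simp
  qed
  have k0: "0 \<le> real k * (l / N)" "0 \<le> l / N" "0 \<le> \<beta> / 4 * l" using l assms by auto
  have "(real k + 1) * (l / N) = real k * (l / N) + l / N" "snd B = fst B + l"
    by (simp_all add: l_def len_def distrib_right add_divide_distrib)
  note piece = this
  then have "fst A \<le> snd A"
    using kN k0 unfolding A_def by simp
  moreover have "len A \<le> \<beta> * len B"
  proof -
    have "fst B + real k * (l / N) - \<beta> / 4 * l \<le> fst A"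
      "snd A \<le> fst B + real k * (l / N) + l / N + \<beta> / 4 * l"
      unfolding A_def using piece(1) by simp_all
    then show ?thesis using lN by (simp add: len_def[of A] flip: l_def)
  qed
  ultimately have "alice_legal \<beta> B A" by (auto simp: alice_legal_def A_def ivl_def)
  moreover have "mass v {i\<in>active U s B. U i \<inter> ivl B' \<noteq> {}}
      \<le> ennreal (1 - 1 / N) * mass v (active U s B)"
    if small: "\<forall>i\<in>active U s B. \<forall>x\<in>U i. \<forall>y\<in>U i. \<bar>x - y\<bar> \<le> \<beta> / 4 * len B"
      and fin: "mass v (active U s B) < \<infinity>"
      and B': "ivl B' \<subseteq> ivl B - ivl A" for B'
  proof -
    let ?R = "{i\<in>active U s B. U i \<inter> ivl B' \<noteq> {}}"
    have "?R \<inter> H k = {}"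
    proof (rule equals0I)
      fix i assume "i \<in> ?R \<inter> H k"
      then obtain x y where i: "i \<in> active U s B" and x: "x \<in> U i" "x \<in> ivl B'"
        and y: "y \<in> U i" "y \<in> P k"
        by (auto simp: H_def)
      have "\<bar>x - y\<bar> \<le> \<beta> / 4 * l" using small i x y by (auto simp: l_def)
      moreover have "fst B + real k * (l / N) \<le> y" "y \<le> fst B + (real k + 1) * (l / N)"
        using y(2) by (auto simp: P_def)
      ultimately have "fst B + real k * (l / N) - \<beta> / 4 * l \<le> x"
        "x \<le> fst B + (real k + 1) * (l / N) + \<beta> / 4 * l"
        by linarith+
      moreover have "x \<in> ivl B" "x \<notin> ivl A" using B' x by auto
      ultimately show False by (simp add: A_def ivl_def)
    qed
    then have "mass v ?R + mass v (H k) = mass v (?R \<union> H k)" by (simp add: mass_Un_disjoint)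
    also have "\<dots> \<le> mass v (active U s B)" by (rule mass_mono) (auto simp: H_def)
    finally show ?thesis using heavy fin N by (intro heavy_part_removed) auto
  qed
  ultimately show ?thesis by blast
qed

text \<open>
  The weight of all obstacles attached to finitely many words, for all indices \<open>j\<close> at once: a geometric series in
  \<open>2\<^sup>-\<^sup>c\<close>. The factors \<open>2\<^sup>-\<^sup>j\<close> in the diameters are what allows countably many families.
\<close>

lemma mass_weights_le:
  fixes m :: "'w \<Rightarrow> real"
  assumes "finite W" "card W \<le> N" "\<And>w. w \<in> W \<Longrightarrow> 0 < m w \<and> m w \<le> t" "0 < \<eta>" "0 < c" "0 < t"
    and "X \<subseteq> UNIV \<times> W"
  shows "mass (\<lambda>(j::nat, w). (\<eta> * (1/2)^j * m w) powr c) X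
           \<le> ennreal (N * (\<eta> powr c * t powr c) / (1 - (1/2) powr c))"
proof -
  let ?v = "\<lambda>(j::nat, w). (\<eta> * (1/2)^j * m w) powr c"
  let ?e = "N * (\<eta> powr c * t powr c)"
  have q: "(1/2::real) powr c < 1" using assms(5) powr_less_mono2[of c "1/2" 1] by simp
  have lvl: "mass ?v ({j} \<times> W) \<le> ennreal (?e * ((1/2) powr c) ^ j)" for j
  proof -
    have "mass ?v ({j} \<times> W) = (\<Sum>i\<in>{j} \<times> W. ennreal (?v i))"
      using assms(1) by (intro mass_finite) auto
    also have "\<dots> = ennreal (\<Sum>i\<in>{j} \<times> W. ?v i)"
      by (rule sum_ennreal) auto
    also have "\<dots> \<le> ennreal (\<Sum>i\<in>{j} \<times> W. \<eta> powr c * t powr c * ((1/2) powr c) ^ j)"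
    proof (intro ennreal_leI sum_mono)
      fix i assume "i \<in> {j} \<times> W"
      then obtain w where i: "i = (j, w)" and w: "w \<in> W" by auto
      have "?v i \<le> (\<eta> * (1/2)^j * t) powr c"
        unfolding i using assms(3)[OF w] assms(4,5) by (auto intro!: powr_mono2 mult_left_mono)
      also have "\<dots> = \<eta> powr c * t powr c * ((1/2)^j) powr c"
        using assms by (simp add: powr_mult)
      also have "((1/2::real)^j) powr c = ((1/2) powr c) ^ j"
        by (simp add: powr_powr mult.commute flip: powr_realpow)
      finally show "?v i \<le> \<eta> powr c * t powr c * ((1/2) powr c) ^ j" .
    qed
    also have "(\<Sum>i\<in>{j} \<times> W. \<eta> powr c * t powr c * ((1/2) powr c) ^ j) =
        card W * (\<eta> powr c * t powr c * ((1/2) powr c) ^ j)"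
      using assms(1) by (simp add: card_cartesian_product)
    also have "\<dots> \<le> N * (\<eta> powr c * t powr c * ((1/2) powr c) ^ j)"
      using assms(2) by (intro mult_right_mono) auto
    finally show ?thesis by (simp add: mult.assoc ennreal_leI)
  qed
  have "mass ?v X \<le> mass ?v (\<Union>j. {j} \<times> W)"
    using assms(7) by (intro mass_mono) auto
  also have "\<dots> \<le> (\<Sum>j. mass ?v ({j} \<times> W))" by (rule mass_UN_countable_le)
  also have "\<dots> \<le> (\<Sum>j. ennreal (?e * ((1/2) powr c) ^ j))"
    by (intro suminf_le lvl) auto
  also have "\<dots> = ennreal (?e * (1 / (1 - (1/2) powr c)))"
  proof (rule suminf_ennreal_eq)
    show "(\<lambda>j. ?e * ((1/2) powr c) ^ j) sums (?e * (1 / (1 - (1/2) powr c)))"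
      using q by (intro sums_mult geometric_sums) auto
  qed auto
  finally show ?thesis by simp
qed

lemma nested_play:
  assumes "\<And>n. bob_legal \<beta> I \<sigma> B n"
  shows "fst (B 0) < snd (B 0)" "ivl (B 0) \<subseteq> I" "\<And>k. fst (B k) \<le> snd (B k)"
    "\<And>k. ivl (B (Suc k)) \<subseteq> ivl (B k) - ivl (alice_move \<sigma> B k)"
    "\<And>k. \<beta> * len (B k) \<le> len (B (Suc k))"
proof -
  have s: "\<And>k. fst (B (Suc k)) \<le> snd (B (Suc k)) \<and>
            ivl (B (Suc k)) \<subseteq> ivl (B k) - ivl (alice_move \<sigma> B k) \<and>
            len (B (Suc k)) \<ge> \<beta> * len (B k)"
    using assms unfolding bob_legal_def by blast
  show 0: "fst (B 0) < snd (B 0)" "ivl (B 0) \<subseteq> I" using assms[of 0] by (auto simp: bob_legal_def)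
  show "\<And>k. fst (B k) \<le> snd (B k)" subgoal for k using s 0 by (cases k) auto done
  show "\<And>k. ivl (B (Suc k)) \<subseteq> ivl (B k) - ivl (alice_move \<sigma> B k)"
    "\<And>k. \<beta> * len (B k) \<le> len (B (Suc k))" using s by blast+
qed

text \<open>
  With \<open>m w\<close> in the role of the size of \<open>C w\<close>, an obstacle has at most the proportion \<open>\<eta>\<close> of the size of its cylinder,
  and only boundedly many cylinders of size comparable with a given interval meet it. It suffices for Alice to
  avoid, for each \<open>j\<close>, all the \<open>U j w \<eta>\<^sub>j\<close> for some \<open>\<eta>\<^sub>j > 0\<close> of her choice, which may depend on Bob's first
  interval. She keeps the potential below \<open>(\<beta> / 4 \<bar>B\<bar>)\<^sup>c\<close>; this says in particular that each active obstacle is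
  no longer than the margin in \<open>heavy_deletion\<close>, so that the next such move is effective.
\<close>

theorem beta_absolute_winning_if_sparse_obstacles:
  fixes U :: "nat \<Rightarrow> 'w \<Rightarrow> real \<Rightarrow> real set" and C :: "'w \<Rightarrow> real set" and m :: "'w \<Rightarrow> real"
  assumes \<beta>: "0 < \<beta>" "\<beta> < 1"
    and m_pos: "\<And>w. 0 < m w" and m_le: "\<And>w. m w \<le> m0"
    and U_sub: "\<And>j w \<eta>. 0 < \<eta> \<Longrightarrow> U j w \<eta> \<subseteq> C w"
    and U_diam: "\<And>j w \<eta> x y. 0 < \<eta> \<Longrightarrow> x \<in> U j w \<eta> \<Longrightarrow> y \<in> U j w \<eta> \<Longrightarrow> \<bar>x - y\<bar> \<le> \<eta> * m w"
    and sparse: "\<And>\<kappa>. \<exists>N. \<forall>x y. x < y \<longrightarrow>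
        finite {w. C w \<inter> {x..y} \<noteq> {} \<and> y - x \<le> m w \<and> m w \<le> \<kappa> * (y - x)} \<and>
        card {w. C w \<inter> {x..y} \<noteq> {} \<and> y - x \<le> m w \<and> m w \<le> \<kappa> * (y - x)} \<le> N"
    and win: "\<And>x. x \<in> I \<Longrightarrow> (\<And>j. \<exists>\<eta>>0. \<forall>w. x \<notin> U j w \<eta>) \<Longrightarrow> x \<in> S"
  shows "beta_absolute_winning \<beta> I S"
proof -
  define near where "near \<kappa> B = {w. C w \<inter> ivl B \<noteq> {} \<and> len B \<le> m w \<and> m w \<le> \<kappa> * len B}" for \<kappa> B
  have "\<forall>\<kappa>. \<exists>N. \<forall>x y. x < y \<longrightarrow> finite (near \<kappa> (x, y)) \<and> card (near \<kappa> (x, y)) \<le> N"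
    unfolding near_def ivl_def len_def fst_conv snd_conv by (rule allI, rule sparse)
  from choice[OF this] obtain N1 :: "real \<Rightarrow> nat"
    where "\<forall>\<kappa> x y. x < y \<longrightarrow> finite (near \<kappa> (x, y)) \<and> card (near \<kappa> (x, y)) \<le> N1 \<kappa>"
    by blast
  then have near: "finite (near \<kappa> B)" "card (near \<kappa> B) \<le> N1 \<kappa>" if "0 < len B" for \<kappa> B
    using that by (cases B; simp add: len_def)+
  have m0: "0 < m0" using m_pos m_le by (rule less_le_trans)
  define N where "N = nat \<lceil>2 / \<beta>\<rceil> + 1"
  have N: "0 < N" "2 \<le> \<beta> * N"
  proof -
    have "2 / \<beta> \<le> N" unfolding N_def by linarith
    then show "2 \<le> \<beta> * N" using \<beta> by (simp add: field_simps)
  qed (simp add: N_def)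
  define \<theta> where "\<theta> = 1 - 1 / real N"
  have \<theta>: "0 \<le> \<theta>" "\<theta> < 1" using N by (auto simp: \<theta>_def)
  \<comment> \<open>The exponent makes \<open>\<theta>\<close> times the growth factor \<open>\<beta>\<^sup>-\<^sup>2\<^sup>c\<close> equal to \<open>2 \<theta> / (1 + \<theta>) < 1\<close>. The square is there
      because two of Bob's moves pass between two heavy deletions.\<close>
  define c where "c = ln ((1 + \<theta>) / 2) / ln (\<beta>\<^sup>2)"
  have b2: "0 < \<beta>\<^sup>2" "\<beta>\<^sup>2 < 1" using \<beta> by (auto simp: power_less_one_iff)
  have c: "0 < c" using \<theta> b2 unfolding c_def by (intro divide_neg_neg) (auto intro: ln_less_zero)
  have b2c: "(\<beta>\<^sup>2) powr c = (1 + \<theta>) / 2"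
    using \<theta> b2 by (simp add: c_def powr_def)
  define M where "M = (\<beta> / 4) powr c"
  have M: "0 < M" using \<beta> by (simp add: M_def)
  define Z where "Z = 1 / (1 - (1/2::real) powr c)"
  have Z: "0 < Z" using c powr_less_mono2[of c "1/2" 1] by (simp add: Z_def)

  \<comment> \<open>The first condition bounds the weight activated in a later round, the second one the initial weight
      when Bob's first interval has length \<open>l\<close>.\<close>
  have "\<exists>\<eta>>0. N1 (1 / \<beta>\<^sup>2) * Z * \<eta> powr c \<le> M * (1 - \<theta>) / 2 \<and>
      N1 (m0 / l) * Z * \<eta> powr c * m0 powr c \<le> M * l powr c" if l: "0 < l" for l
  proof -
    define a1 a2 where "a1 = N1 (1 / \<beta>\<^sup>2) * Z + 1" and "a2 = N1 (m0 / l) * Z * m0 powr c + 1"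
    have a: "1 \<le> a1" "1 \<le> a2" using Z by (auto simp: a1_def a2_def)
    define e where "e = min (M * (1 - \<theta>) / 2 / a1) (M * l powr c / a2)"
    have e: "0 < e" "e \<le> M * (1 - \<theta>) / 2 / a1" "e \<le> M * l powr c / a2"
      unfolding e_def using M \<theta> l a by (auto intro!: divide_pos_pos)
    have "a1 * e \<le> M * (1 - \<theta>) / 2" "a2 * e \<le> M * l powr c"
      using a e by (auto simp: field_simps)
    moreover have "N1 (1 / \<beta>\<^sup>2) * Z * e \<le> a1 * e" "N1 (m0 / l) * Z * m0 powr c * e \<le> a2 * e"
      using e by (auto simp: a1_def a2_def intro!: mult_right_mono)
    ultimately have "N1 (1 / \<beta>\<^sup>2) * Z * e \<le> M * (1 - \<theta>) / 2"
      "N1 (m0 / l) * Z * m0 powr c * e \<le> M * l powr c"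
      by linarith+
    moreover have "(e powr (1 / c)) powr c = e" using c e by (simp add: powr_powr)
    ultimately show ?thesis using e(1) by (intro exI[of _ "e powr (1 / c)"]) (simp add: ac_simps)
  qed
  then obtain \<eta> where \<eta>: "\<And>l. 0 < l \<Longrightarrow> 0 < \<eta> l"
    "\<And>l. 0 < l \<Longrightarrow> N1 (1 / \<beta>\<^sup>2) * Z * \<eta> l powr c \<le> M * (1 - \<theta>) / 2"
    "\<And>l. 0 < l \<Longrightarrow> N1 (m0 / l) * Z * \<eta> l powr c * m0 powr c \<le> M * l powr c"
    by metis

  define obst where "obst h = (\<lambda>(j, w). U j w (h * (1/2)^j))" for h
  define v where "v h = (\<lambda>(j::nat, w). (h * (1/2)^j * m w) powr c)" for h
  define act where "act h B = active (obst h) (\<lambda>(j, w). m w) B" for h B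
  define good where "good h B A \<longleftrightarrow> alice_legal \<beta> B A \<and>
    ((\<forall>i\<in>act h B. \<forall>x\<in>obst h i. \<forall>y\<in>obst h i. \<bar>x - y\<bar> \<le> \<beta> / 4 * len B) \<longrightarrow>
     mass (v h) (act h B) < \<infinity> \<longrightarrow>
     (\<forall>B'. ivl B' \<subseteq> ivl B - ivl A \<longrightarrow>
        mass (v h) {i\<in>act h B. obst h i \<inter> ivl B' \<noteq> {}} \<le> ennreal \<theta> * mass (v h) (act h B)))" for h B A
  define heavy where "heavy h B = (SOME A. good h B A)" for h B
  have heavy: "good h B (heavy h B)" if "fst B \<le> snd B" for h B
    unfolding heavy_def good_def act_def \<theta>_def by (rule someI_ex, rule heavy_deletion[OF \<beta>(1) N(2) that])
  define mid where "mid B = ((fst B + snd B) / 2, (fst B + snd B) / 2)" for B :: interval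
  \<comment> \<open>Heavy deletions alternate with deletions of the midpoint, which force the lengths to tend to \<open>0\<close>.
      In the round with index \<open>n\<close> the history has length \<open>n + 1\<close>, hence an odd one for heavy deletions.\<close>
  define \<sigma> where "\<sigma> Bs = (if odd (length Bs) then heavy (\<eta> (len (hd Bs))) (last Bs) else mid (last Bs))" for Bs
  have move: "alice_move \<sigma> B n = (if even n then heavy (\<eta> (len (B 0))) (B n) else mid (B n))" for B n
    by (simp add: alice_move_def \<sigma>_def hd_map last_map del: upt_Suc)

  show ?thesis unfolding beta_absolute_winning_def
  proof (intro exI[of _ \<sigma>] conjI allI impI)
    fix B n assume "bob_legal \<beta> I \<sigma> B n"
    then have le: "fst (B n) \<le> snd (B n)" unfolding bob_legal_def by (cases n) auto
    show "alice_legal \<beta> (B n) (alice_move \<sigma> B n)"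
    proof (cases "even n")
      case True
      then show ?thesis using heavy[OF le] by (simp add: move good_def)
    next
      case False
      then show ?thesis using le \<beta> by (auto simp: move mid_def alice_legal_def ivl_def len_def)
    qed
  next
    fix B assume legal: "\<forall>n. bob_legal \<beta> I \<sigma> B n"
    note play = nested_play[OF legal[rule_format]]
    define h where "h = \<eta> (len (B 0))"
    have l0: "0 < len (B 0)" using play(1) by (simp add: len_def)
    have h: "0 < h" "N1 (1 / \<beta>\<^sup>2) * Z * h powr c \<le> M * (1 - \<theta>) / 2"
      "N1 (m0 / len (B 0)) * Z * h powr c * m0 powr c \<le> M * len (B 0) powr c"
      using \<eta>[OF l0] by (simp_all add: h_def)
    define D where "D n = B (2 * n)" for n
    have len_pos: "0 < len (B n)" for n
      by (induction n) (use l0 play(5) \<beta> in \<open>auto intro: less_le_trans mult_pos_pos\<close>)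
    have D_ge: "\<beta>\<^sup>2 * len (D n) \<le> len (D (Suc n))" for n
    proof -
      have "\<beta> * (\<beta> * len (B (2 * n))) \<le> \<beta> * len (B (Suc (2 * n)))"
        using play(5)[of "2 * n"] \<beta> by (intro mult_left_mono) auto
      also have "\<dots> \<le> len (B (Suc (Suc (2 * n))))" using play(5) .
      finally show ?thesis by (simp add: D_def power2_eq_square mult.assoc)
    qed
    have D_sub: "ivl (D (Suc n)) \<subseteq> ivl (D n) - ivl (heavy h (D n))" for n
      using play(4)[of "2 * n"] play(4)[of "Suc (2 * n)"]
      by (auto simp: D_def move h_def)
    have D_half: "len (D (Suc n)) \<le> len (D n) / 2" for n
    proof -
      let ?E = "B (Suc (2 * n))" and ?F = "B (Suc (Suc (2 * n)))"
      have "ivl ?E \<subseteq> ivl (B (2 * n))" using play(4)[of "2 * n"] by auto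
      then have "len ?E \<le> len (B (2 * n))" using play(3)[of "Suc (2 * n)"] by (auto simp: ivl_def len_def)
      moreover have "ivl ?F \<subseteq> ivl ?E - {(fst ?E + snd ?E) / 2}"
        using play(4)[of "Suc (2 * n)"] by (auto simp: move mid_def ivl_def)
      then have "fst ?E \<le> fst ?F" "snd ?F \<le> snd ?E" "(fst ?E + snd ?E) / 2 \<notin> {fst ?F..snd ?F}"
        using play(3)[of "Suc (Suc (2 * n))"] unfolding ivl_def by fastforce+
      then have "len ?F \<le> len ?E / 2" by (auto simp: len_def)
      ultimately show ?thesis by (simp add: D_def)
    qed
    have D_pow: "len (D n) \<le> len (B 0) * (1/2)^n" for n
    proof (induction n)
      case (Suc n)
      then show ?case using D_half[of n] by simp
    qed (simp add: D_def)
    have D_tendsto: "(\<lambda>n. len (D n)) \<longlonglongrightarrow> 0"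
    proof (rule tendsto_sandwich[of "\<lambda>_. 0"])
      show "(\<lambda>n. len (B 0) * (1/2)^n) \<longlonglongrightarrow> 0"
        by (intro tendsto_mult_right_zero LIMSEQ_realpow_zero) auto
    qed (use D_pow len_pos in \<open>auto simp: D_def less_imp_le\<close>)

    have weight_small: "h * (1/2)^j * m w \<le> \<beta> / 4 * len (D n)"
      if "mass (v h) (act h (D n)) \<le> ennreal (M * len (D n) powr c)" "(j, w) \<in> act h (D n)" for n j w
    proof (rule ccontr)
      assume *: "\<not> ?thesis"
      have "ennreal (v h (j, w)) = mass (v h) {(j, w)}" by (simp add: mass_finite)
      also have "\<dots> \<le> mass (v h) (act h (D n))" using that by (intro mass_mono) auto
      also note that(1)
      finally have "(h * (1/2)^j * m w) powr c \<le> M * len (D n) powr c"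
        using M by (simp add: v_def)
      also have "\<dots> = (\<beta> / 4 * len (D n)) powr c"
        using \<beta> len_pos[of "2 * n"] by (subst powr_mult) (auto simp: M_def D_def less_imp_le)
      also have "\<dots> < (h * (1/2)^j * m w) powr c"
        using * \<beta> len_pos[of "2 * n"] c by (intro powr_less_mono2) (auto simp: D_def)
      finally show False by simp
    qed

    \<comment> \<open>The active obstacles of a round are survivors of the heavy deletion, or their scale lies
        between the lengths of the two intervals.\<close>
    have inv: "mass (v h) (act h (D n)) \<le> ennreal (M * len (D n) powr c)" for n
    proof (induction n)
      case 0
      have "act h (D 0) \<subseteq> UNIV \<times> near (m0 / len (B 0)) (B 0)"
      proof
        fix i assume i: "i \<in> act h (D 0)"
        obtain j w where jw: "i = (j, w)" by force
        have "obst h i \<subseteq> C w" using U_sub h(1) by (simp add: jw obst_def)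
        moreover from i have "len (B 0) \<le> m w" "obst h i \<inter> ivl (B 0) \<noteq> {}"
          by (auto simp: act_def active_def jw D_def)
        moreover have "m w \<le> m0 / len (B 0) * len (B 0)" using m_le l0 by simp
        ultimately show "i \<in> UNIV \<times> near (m0 / len (B 0)) (B 0)"
          unfolding near_def jw by blast
      qed
      then have "mass (v h) (act h (D 0)) \<le>
          ennreal (N1 (m0 / len (B 0)) * (h powr c * m0 powr c) / (1 - (1/2) powr c))"
        unfolding v_def using near[OF l0] m_pos m_le h(1) c m0 by (intro mass_weights_le) auto
      also have "\<dots> \<le> ennreal (M * len (D 0) powr c)"
        using h(3) by (intro ennreal_leI) (simp add: D_def Z_def mult_ac)
      finally show ?case .
    next
      case (Suc n)
      let ?l = "len (D n)" and ?l' = "len (D (Suc n))"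
      have l: "0 < ?l" "0 < ?l'" using len_pos by (auto simp: D_def)
      let ?old = "{i\<in>act h (D n). obst h i \<inter> ivl (D (Suc n)) \<noteq> {}}"
      let ?new = "act h (D (Suc n)) - ?old"
      have "mass (v h) ?old \<le> ennreal \<theta> * mass (v h) (act h (D n))"
      proof -
        have "\<bar>x - y\<bar> \<le> \<beta> / 4 * len (D n)" if "i \<in> act h (D n)" "x \<in> obst h i" "y \<in> obst h i" for i x y
        proof -
          obtain j w where i: "i = (j, w)" by force
          have "\<bar>x - y\<bar> \<le> h * (1/2)^j * m w"
            using that h(1) unfolding i obst_def by (intro U_diam) auto
          also have "\<dots> \<le> \<beta> / 4 * len (D n)" using weight_small[OF Suc.IH] that i by simp
          finally show ?thesis .
        qed
        moreover have "mass (v h) (act h (D n)) < \<infinity>" using Suc.IH by (simp add: le_less_trans)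
        ultimately show ?thesis
          using heavy[of "D n" h] play(3)[of "2 * n"] D_sub[of n] unfolding good_def D_def by blast
      qed
      also have "\<dots> \<le> ennreal \<theta> * ennreal (M * ?l powr c)"
        by (intro mult_left_mono Suc.IH) simp
      finally have old: "mass (v h) ?old \<le> ennreal (\<theta> * (M * ?l powr c))"
        using \<theta> by (simp add: ennreal_mult')
      have "?new \<subseteq> UNIV \<times> {w \<in> near (1 / \<beta>\<^sup>2) (D (Suc n)). m w \<le> ?l}"
      proof
        fix i assume i: "i \<in> ?new"
        obtain j w where jw: "i = (j, w)" by force
        have "obst h i \<subseteq> C w" using U_sub h(1) by (simp add: jw obst_def)
        moreover from i have a: "?l' \<le> m w" "obst h i \<inter> ivl (D (Suc n)) \<noteq> {}"
          by (auto simp: act_def active_def jw)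
        moreover have "obst h i \<inter> ivl (D n) \<noteq> {}" using a(2) D_sub[of n] by auto
        then have "m w < ?l" using i a by (auto simp: act_def active_def jw)
        moreover have "?l \<le> 1 / \<beta>\<^sup>2 * ?l'" using D_ge[of n] b2 by (simp add: field_simps)
        ultimately show "i \<in> UNIV \<times> {w \<in> near (1 / \<beta>\<^sup>2) (D (Suc n)). m w \<le> ?l}"
          by (auto simp: near_def jw)
      qed
      then have "mass (v h) ?new \<le>
          ennreal (N1 (1 / \<beta>\<^sup>2) * (h powr c * ?l powr c) / (1 - (1/2) powr c))"
        unfolding v_def using near[OF l(2)] m_pos h(1) c l(1)
        by (intro mass_weights_le) (auto intro: order_trans[OF card_mono[of "near (1 / \<beta>\<^sup>2) (D (Suc n))"]])
      also have "\<dots> = ennreal (N1 (1 / \<beta>\<^sup>2) * Z * h powr c * ?l powr c)"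
        by (simp add: Z_def mult.assoc)
      also have "\<dots> \<le> ennreal (M * (1 - \<theta>) / 2 * ?l powr c)"
        using h(2) by (intro ennreal_leI mult_right_mono) auto
      finally have new: "mass (v h) ?new \<le> ennreal (M * (1 - \<theta>) / 2 * ?l powr c)" .
      have "mass (v h) (act h (D (Suc n))) \<le> mass (v h) (?old \<union> ?new)" by (rule mass_mono) auto
      also have "\<dots> \<le> mass (v h) ?old + mass (v h) ?new" by (rule mass_Un_le)
      also have "\<dots> \<le> ennreal (\<theta> * (M * ?l powr c)) + ennreal (M * (1 - \<theta>) / 2 * ?l powr c)"
        by (intro add_mono old new)
      also have "\<dots> = ennreal (\<theta> * (M * ?l powr c) + M * (1 - \<theta>) / 2 * ?l powr c)"
        using \<theta> M by (intro ennreal_plus[symmetric]) auto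
      also have "\<theta> * (M * ?l powr c) + M * (1 - \<theta>) / 2 * ?l powr c = M * ((1 + \<theta>) / 2 * ?l powr c)"
        by (simp add: field_simps)
      also have "\<dots> = M * (\<beta>\<^sup>2 * ?l) powr c"
        using l b2 by (simp add: powr_mult flip: b2c)
      also have "ennreal (M * (\<beta>\<^sup>2 * ?l) powr c) \<le> ennreal (M * ?l' powr c)"
        using D_ge[of n] M c l b2 by (intro ennreal_leI mult_left_mono powr_mono2) auto
      finally show ?case .
    qed

    have "(\<Inter>n. ivl (B n)) \<noteq> {}"
    proof (rule compact_nest)
      show "compact (ivl (B n))" "ivl (B n) \<noteq> {}" for n using play(3) by (auto simp: ivl_def)
      show "ivl (B n) \<subseteq> ivl (B k)" if "k \<le> n" for k n
        using that by (rule lift_Suc_antimono_le[rotated]) (use play(4) in blast)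
    qed
    then obtain x where x: "\<And>n. x \<in> ivl (B n)" by auto
    have "x \<in> S"
    proof (rule win)
      show "x \<in> I" using x[of 0] play(2) by auto
      fix j
      have "x \<notin> U j w (h * (1/2)^j)" for w
      proof
        assume xU: "x \<in> U j w (h * (1/2)^j)"
        define t where "t = min (m w) (h * (1/2)^j * m w)"
        have "0 < t" using m_pos h(1) by (simp add: t_def)
        with D_tendsto obtain n where n: "len (D n) < t"
          by (metis (no_types, lifting) eventually_sequentially order_refl order_tendstoD(2))
        have "(j, w) \<in> act h (D n)"
          using n xU x[of "2 * n"] by (auto simp: act_def active_def obst_def D_def t_def)
        from weight_small[OF inv this] have "t \<le> \<beta> / 4 * len (D n)" by (simp add: t_def)
        also have "\<dots> \<le> 1 * len (D n)"
          using \<beta> len_pos[of "2 * n"] by (intro mult_right_mono) (auto simp: D_def)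
        finally show False using n by simp
      qed
      then show "\<exists>\<eta>>0. \<forall>w. x \<notin> U j w \<eta>" using h(1) by (intro exI[of _ "h * (1/2)^j"]) auto
    qed
    then show "(\<Inter>n. ivl (B n)) \<inter> S \<noteq> {}" using x by blast
  qed
qed

section \<open>Bounded distortion and cylinders of contracting branches\<close>

lemma mean_value:
  fixes f :: "real \<Rightarrow> real"
  assumes "x < y" "continuous_on {x..y} f"
    and "\<And>t. x < t \<Longrightarrow> t < y \<Longrightarrow> (f has_real_derivative f' t) (at t)"
  shows "\<exists>t. x < t \<and> t < y \<and> f y - f x = f' t * (y - x)"
proof -
  have "f differentiable (at t)" if "x < t" "t < y" for t
    using assms(3)[OF that] real_differentiable_def by blast
  from MVT[OF assms(1,2) this] obtain l t
    where "x < t" "t < y" "DERIV f t :> l" "f y - f x = (y - x) * l" by blast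
  with assms(3)[of t] show ?thesis by (metis DERIV_unique mult.commute)
qed

lemma mean_value_abs:
  fixes f :: "real \<Rightarrow> real"
  assumes "x \<in> {a..b}" "y \<in> {a..b}" "x \<noteq> y" "continuous_on {a..b} f"
    and "\<And>t. t \<in> {a<..<b} \<Longrightarrow> (f has_real_derivative f' t) (at t)"
  shows "\<exists>t\<in>{a<..<b}. \<bar>f x - f y\<bar> = \<bar>f' t\<bar> * \<bar>x - y\<bar>"
proof -
  have *: "\<exists>t\<in>{a<..<b}. \<bar>f x - f y\<bar> = \<bar>f' t\<bar> * \<bar>x - y\<bar>"
    if xy: "x \<in> {a..b}" "y \<in> {a..b}" "x < y" for x y
  proof -
    have "continuous_on {x..y} f" using xy by (intro continuous_on_subset[OF assms(4)]) auto
    from mean_value[OF xy(3) this, of f'] obtain t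
      where t: "x < t" "t < y" "f y - f x = f' t * (y - x)" using assms(5) xy by auto
    then have "\<bar>f y - f x\<bar> = \<bar>f' t\<bar> * \<bar>y - x\<bar>" by (simp add: abs_mult)
    then show ?thesis using t xy by (intro bexI[of _ t]) (auto simp: abs_minus_commute)
  qed
  show ?thesis using *[of x y] *[of y x] assms(1-3) by (cases "x < y") (auto simp: abs_minus_commute)
qed

text \<open>
  Countably many contractions of \<open>[a, b]\<close> whose images of the open interval are disjoint, with derivatives that are
  log-Lipschitz uniformly in the branch: the inverse branches of a uniformly expanding full-branched map. Only the
  images of the open interval are disjoint, as neighbouring cylinders share end points.
\<close>

locale markov_contractions =
  fixes a b :: real and g g' :: "nat \<Rightarrow> real \<Rightarrow> real" and \<mu> L :: real
  assumes ab: "a < b" and \<mu>: "0 < \<mu>" "\<mu> < 1" and L: "0 \<le> L"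
    and cont: "\<And>i. continuous_on {a..b} (g i)"
    and maps: "\<And>i x. x \<in> {a..b} \<Longrightarrow> g i x \<in> {a..b}"
    and maps_open: "\<And>i x. x \<in> {a<..<b} \<Longrightarrow> g i x \<in> {a<..<b}"
    and disj: "\<And>i j x y. x \<in> {a<..<b} \<Longrightarrow> y \<in> {a<..<b} \<Longrightarrow> g i x = g j y \<Longrightarrow> i = j"
    and deriv: "\<And>i x. x \<in> {a<..<b} \<Longrightarrow> (g i has_real_derivative g' i x) (at x)"
    and deriv_nz: "\<And>i x. x \<in> {a<..<b} \<Longrightarrow> g' i x \<noteq> 0"
    and contr: "\<And>i x. x \<in> {a<..<b} \<Longrightarrow> \<bar>g' i x\<bar> \<le> \<mu>"
    and dist: "\<And>i x y. x \<in> {a<..<b} \<Longrightarrow> y \<in> {a<..<b} \<Longrightarrow>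
        \<bar>g' i x\<bar> \<le> exp (L * \<bar>x - y\<bar>) * \<bar>g' i y\<bar>"
begin

primrec word :: "nat list \<Rightarrow> real \<Rightarrow> real" where
  "word [] = id"
| "word (i # w) = g i \<circ> word w"

primrec word' :: "nat list \<Rightarrow> real \<Rightarrow> real" where
  "word' [] x = 1"
| "word' (i # w) x = g' i (word w x) * word' w x"

text \<open>
  The length of the cylinder of \<open>w\<close>; the branches may reverse orientation.
\<close>

definition size_of :: "nat list \<Rightarrow> real" where
  "size_of w = \<bar>word w b - word w a\<bar>"

definition distortion :: real where
  "distortion = exp (L / (1 - \<mu>) * (b - a))"

lemma word_append: "word (w @ v) x = word w (word v x)"
  by (induction w) auto

lemma word_maps: "x \<in> {a..b} \<Longrightarrow> word w x \<in> {a..b}"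
  by (induction w) (use maps in auto)

lemma word_maps_open: "x \<in> {a<..<b} \<Longrightarrow> word w x \<in> {a<..<b}"
  by (induction w) (use maps_open in auto)

lemma word_cont: "continuous_on {a..b} (word w)"
proof (induction w)
  case (Cons i w)
  have "word w ` {a..b} \<subseteq> {a..b}" using word_maps by blast
  then show ?case
    unfolding word.simps
    by (intro continuous_on_compose Cons.IH continuous_on_subset[OF cont])
qed simp

lemma word_deriv: "x \<in> {a<..<b} \<Longrightarrow> (word w has_real_derivative word' w x) (at x)"
proof (induction w)
  case (Cons i w)
  then show ?case
    using DERIV_chain[OF deriv[OF word_maps_open] Cons.IH] by (simp add: o_def)
qed (simp add: id_def)

lemma word'_nz: "x \<in> {a<..<b} \<Longrightarrow> word' w x \<noteq> 0"
  by (induction w) (use deriv_nz word_maps_open in auto)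

lemma word'_le: "x \<in> {a<..<b} \<Longrightarrow> \<bar>word' w x\<bar> \<le> \<mu> ^ length w"
proof (induction w)
  case (Cons i w)
  then show ?case
    using contr[OF word_maps_open, of x i w] \<mu> by (auto simp: abs_mult intro!: mult_mono)
qed simp

lemma word_mvt:
  assumes "x \<in> {a..b}" "y \<in> {a..b}" "x \<noteq> y"
  shows "\<exists>t\<in>{a<..<b}. \<bar>word w x - word w y\<bar> = \<bar>word' w t\<bar> * \<bar>x - y\<bar>"
  using assms word_cont word_deriv by (rule mean_value_abs)

lemma word_contracts:
  assumes "x \<in> {a..b}" "y \<in> {a..b}"
  shows "\<bar>word w x - word w y\<bar> \<le> \<mu> ^ length w * \<bar>x - y\<bar>"
proof (cases "x = y")
  case False
  with assms word_mvt obtain t where "t \<in> {a<..<b}" "\<bar>word w x - word w y\<bar> = \<bar>word' w t\<bar> * \<bar>x - y\<bar>"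
    by blast
  then show ?thesis using word'_le[of t w] by (auto intro: mult_right_mono)
qed simp

lemma word_inj:
  assumes "x \<in> {a..b}" "y \<in> {a..b}" "word w x = word w y"
  shows "x = y"
proof (rule ccontr)
  assume "x \<noteq> y"
  with word_mvt[OF assms(1,2) this, of w] word'_nz assms(3) show False by auto
qed

lemma size_pos: "0 < size_of w"
  using word_inj[of b a w] ab by (auto simp: size_of_def)

text \<open>
  The first letter acts on points that the rest of the word has already brought together by the factor
  \<open>\<mu>\<^sup>n\<close>, so that the log-Lipschitz constants sum up to a geometric series.
\<close>

lemma word'_distortion:
  assumes "x \<in> {a<..<b}" "y \<in> {a<..<b}"
  shows "\<bar>word' w x\<bar> \<le> exp (L * (\<Sum>k<length w. \<mu> ^ k) * \<bar>x - y\<bar>) * \<bar>word' w y\<bar>"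
proof (induction w)
  case (Cons i w)
  let ?s = "\<Sum>k<length w. \<mu> ^ k"
  have "\<bar>g' i (word w x)\<bar> \<le> exp (L * \<bar>word w x - word w y\<bar>) * \<bar>g' i (word w y)\<bar>"
    using assms by (intro dist word_maps_open)
  also have "\<dots> \<le> exp (L * (\<mu> ^ length w * \<bar>x - y\<bar>)) * \<bar>g' i (word w y)\<bar>"
    using word_contracts[of x y w] assms L by (auto intro!: mult_right_mono mult_left_mono)
  finally have "\<bar>word' (i # w) x\<bar> \<le> (exp (L * (\<mu> ^ length w * \<bar>x - y\<bar>)) * \<bar>g' i (word w y)\<bar>) *
      (exp (L * ?s * \<bar>x - y\<bar>) * \<bar>word' w y\<bar>)"
    unfolding word'.simps abs_mult using Cons.IH by (intro mult_mono) auto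
  also have "\<dots> = exp (L * (\<mu> ^ length w * \<bar>x - y\<bar>) + L * ?s * \<bar>x - y\<bar>) * \<bar>word' (i # w) y\<bar>"
    by (simp add: exp_add abs_mult)
  finally show ?case by (simp add: algebra_simps)
qed simp

lemma word'_bounded_distortion:
  assumes "x \<in> {a<..<b}" "y \<in> {a<..<b}"
  shows "\<bar>word' w x\<bar> \<le> distortion * \<bar>word' w y\<bar>"
proof -
  have "(\<Sum>k<length w. \<mu> ^ k) \<le> 1 / (1 - \<mu>)"
    using \<mu> by (simp add: sum_gp_strict divide_right_mono)
  then have "(L * (\<Sum>k<length w. \<mu> ^ k)) * \<bar>x - y\<bar> \<le> (L * (1 / (1 - \<mu>))) * (b - a)"
    using L assms \<mu> by (intro mult_mono mult_left_mono) auto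
  then have "exp (L * (\<Sum>k<length w. \<mu> ^ k) * \<bar>x - y\<bar>) \<le> distortion"
    by (simp add: distortion_def)
  then show ?thesis using word'_distortion[OF assms, of w]
    by (meson abs_ge_zero mult_right_mono order_trans)
qed

lemma distortion_pos: "0 < distortion" by (simp add: distortion_def)

lemma word_proportion:
  assumes "x \<in> {a..b}" "y \<in> {a..b}"
  shows "\<bar>word w x - word w y\<bar> \<le> distortion / (b - a) * \<bar>x - y\<bar> * size_of w"
proof (cases "x = y")
  case False
  with assms word_mvt obtain t where t: "t \<in> {a<..<b}" "\<bar>word w x - word w y\<bar> = \<bar>word' w t\<bar> * \<bar>x - y\<bar>"
    by blast
  obtain s where s: "s \<in> {a<..<b}" "size_of w = \<bar>word' w s\<bar> * (b - a)"
    using word_mvt[of b a w] ab by (auto simp: size_of_def)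
  have "\<bar>word' w t\<bar> * \<bar>x - y\<bar> \<le> distortion * \<bar>word' w s\<bar> * \<bar>x - y\<bar>"
    using word'_bounded_distortion[OF t(1) s(1)] by (intro mult_right_mono) auto
  also have "\<dots> = distortion / (b - a) * \<bar>x - y\<bar> * (\<bar>word' w s\<bar> * (b - a))" using ab by simp
  finally show ?thesis unfolding t(2) s(2) .
qed simp

lemma size_append: "size_of (w @ v) \<le> distortion * \<mu> ^ length v * size_of w"
proof -
  have "size_of (w @ v) \<le> distortion / (b - a) * \<bar>word v b - word v a\<bar> * size_of w"
    using word_proportion[of "word v b" "word v a" w] word_maps ab
    by (simp add: size_of_def[of "w @ v"] word_append)
  also have "\<dots> \<le> distortion / (b - a) * (\<mu> ^ length v * \<bar>b - a\<bar>) * size_of w"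
    using word_contracts[of b a v] ab distortion_pos size_pos[of w]
    by (intro mult_right_mono mult_left_mono) (auto simp: less_imp_le)
  finally show ?thesis using ab by simp
qed

lemma size_le: "size_of w \<le> b - a"
  using word_maps[of a w] word_maps[of b w] ab by (auto simp: size_of_def)

lemma same_length_disjoint:
  assumes "length w = length v" "x \<in> {a<..<b}" "y \<in> {a<..<b}" "word w x = word v y"
  shows "w = v"
  using assms
proof (induction w v rule: list_induct2)
  case (Cons i w j v)
  then have "g i (word w x) = g j (word v y)" by simp
  moreover from this have "i = j" using Cons.prems by (intro disj[OF word_maps_open word_maps_open])
  ultimately have "word [i] (word w x) = word [i] (word v y)" by simp
  moreover have "word w x \<in> {a..b}" "word v y \<in> {a..b}"
    using Cons.prems greaterThanLessThan_subseteq_atLeastAtMost_iff[of a b a b]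
    by (blast intro: word_maps)+
  ultimately have "word w x = word v y" by (rule word_inj[rotated 2])
  with Cons \<open>i = j\<close> show ?case by auto
qed simp

text \<open>
  Cylinders whose interiors meet are nested, because the prefix of \<open>v\<close> of the length of \<open>w\<close> must be \<open>w\<close>.
\<close>

lemma cylinders_nested:
  assumes "length w \<le> length v" "x \<in> {a<..<b}" "y \<in> {a<..<b}" "word w x = word v y"
  shows "\<exists>u. v = w @ u"
proof
  have "word v y = word (take (length w) v) (word (drop (length w) v) y)"
    by (simp flip: word_append)
  then have "w = take (length w) v"
    using assms by (intro same_length_disjoint[of _ _ x "word (drop (length w) v) y"] word_maps_open) auto
  then show "v = w @ drop (length w) v" by (metis append_take_drop_id)
qed

text \<open>
  The cylinders whose interior contains \<open>p\<close> form a chain with one member of each length at most, and each further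
  letter reduces the size geometrically. So the lengths of words of comparable size lie in a window whose width \<open>M\<close>
  depends on the ratio \<open>\<kappa>\<close> only. The bound \<open>\<bar>\<kappa>\<bar> + 1\<close> in place of \<open>\<kappa>\<close> spares a case distinction on the sign.
\<close>

lemma cylinders_at_point:
  "\<exists>M. \<forall>l p. 0 < l \<longrightarrow>
     finite {w. p \<in> word w ` {a<..<b} \<and> l \<le> size_of w \<and> size_of w \<le> \<kappa> * l} \<and>
     card {w. p \<in> word w ` {a<..<b} \<and> l \<le> size_of w \<and> size_of w \<le> \<kappa> * l} \<le> M"
proof -
  define c where "c = distortion * (\<bar>\<kappa>\<bar> + 1)"
  have c: "0 < c" using distortion_pos by (simp add: c_def add_nonneg_pos)
  then obtain M where "\<mu> ^ M < 1 / c"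
    using real_arch_pow_inv[of "1 / c" \<mu>] \<mu> by auto
  then have "c * \<mu> ^ M < 1" using c by (simp add: field_simps)
  then have M: "distortion * \<mu> ^ M * (\<bar>\<kappa>\<bar> + 1) < 1" by (simp add: c_def mult_ac)
  show ?thesis
  proof (intro exI[of _ M] allI impI)
    fix l p :: real assume l: "0 < l"
    let ?X = "{w. p \<in> word w ` {a<..<b} \<and> l \<le> size_of w \<and> size_of w \<le> \<kappa> * l}"
    have "finite ?X \<and> card ?X \<le> M"
    proof (cases "?X = {}")
      case False
      then obtain w where "w \<in> ?X" by blast
      from ex_has_least_nat[of "\<lambda>w. w \<in> ?X", OF this, of length]
      obtain w0 where w0: "w0 \<in> ?X" "\<And>v. v \<in> ?X \<Longrightarrow> length w0 \<le> length v"
        by blast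
      have inj: "inj_on length ?X"
        by (rule inj_onI) (auto intro: same_length_disjoint)
      have range: "length ` ?X \<subseteq> {length w0..<length w0 + M}"
      proof
        fix n assume "n \<in> length ` ?X"
        then obtain v where v: "v \<in> ?X" "n = length v" by blast
        obtain x y where "x \<in> {a<..<b}" "y \<in> {a<..<b}" "word w0 x = word v y"
          using w0(1) v(1) by auto
        then obtain u where u: "v = w0 @ u"
          using cylinders_nested[of w0 v] w0(1) w0(2)[OF v(1)] by blast
        have "length u < M"
        proof (rule ccontr)
          assume "\<not> length u < M"
          then have "\<mu> ^ length u \<le> \<mu> ^ M" using \<mu> by (intro power_decreasing) auto
          have "l \<le> size_of (w0 @ u)" using v u by auto
          also have "\<dots> \<le> distortion * \<mu> ^ length u * size_of w0" by (rule size_append)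
          also have "\<dots> \<le> distortion * \<mu> ^ M * ((\<bar>\<kappa>\<bar> + 1) * l)"
          proof (intro mult_mono mult_left_mono)
            have "size_of w0 \<le> \<kappa> * l" using w0(1) by auto
            also have "\<dots> \<le> (\<bar>\<kappa>\<bar> + 1) * l" using l by (intro mult_right_mono) auto
            finally show "size_of w0 \<le> (\<bar>\<kappa>\<bar> + 1) * l" .
          qed (use \<open>\<mu> ^ length u \<le> \<mu> ^ M\<close> \<mu> distortion_pos size_pos[of w0] in \<open>auto simp: less_imp_le\<close>)
          also have "\<dots> = (distortion * \<mu> ^ M * (\<bar>\<kappa>\<bar> + 1)) * l" by (simp add: mult_ac)
          also have "\<dots> < 1 * l" using M l by (rule mult_strict_right_mono)
          finally show False by simp
        qed
        then show "n \<in> {length w0..<length w0 + M}" using u v by auto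
      qed
      have "finite ?X" using finite_subset[OF range] inj finite_image_iff by auto
      moreover have "card ?X \<le> M"
        using card_mono[OF _ range] card_image[OF inj] by simp
      ultimately show ?thesis by blast
    next
      case True
      then show ?thesis by (simp only: finite.emptyI card.empty zero_le)
    qed
    then show "finite ?X \<and> card ?X \<le> M" .
  qed
qed

text \<open>
  The intermediate value theorem, with the parameter strictly inside \<open>[a, b]\<close> so that \<open>z\<close> is an interior point of the
  cylinder.
\<close>

lemma strictly_between_in_image:
  assumes "u \<in> {a..b}" "v \<in> {a..b}" "word w u < z" "z < word w v"
  shows "z \<in> word w ` {a<..<b}"
proof -
  have "\<exists>s. min u v \<le> s \<and> s \<le> max u v \<and> word w s = z"
  proof (cases "u \<le> v")
    case True
    then show ?thesis using IVT'[of "word w" u z v] assms continuous_on_subset[OF word_cont, of "{u..v}" w]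
      by auto
  next
    case False
    then show ?thesis using IVT2'[of "word w" u z v] assms continuous_on_subset[OF word_cont, of "{v..u}" w]
      by auto
  qed
  then obtain s where s: "min u v \<le> s" "s \<le> max u v" "word w s = z" by blast
  then have "s \<noteq> u" "s \<noteq> v" using assms by auto
  with s assms have "s \<in> {a<..<b}" by (auto simp: min_def max_def split: if_splits)
  with s show ?thesis by blast
qed

text \<open>
  From a common point \<open>x\<close> with the interval \<open>[x0, x0 + 4 h]\<close>, a cylinder of length at least \<open>4 h\<close> extends by at least
  \<open>2 h\<close> to one side, and on that side the next grid point after \<open>x\<close> lies at distance at most \<open>h\<close>. This is why the grid
  exceeds the interval by one point on either side.
\<close>

lemma cylinder_meets_grid:
  assumes h: "0 < h" "4 * h \<le> size_of w" and x: "x \<in> word w ` {a..b}" "x0 \<le> x" "x \<le> x0 + 4 * h"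
  shows "\<exists>k\<in>{-1..5::int}. x0 + k * h \<in> word w ` {a<..<b}"
proof -
  obtain t where t: "t \<in> {a..b}" "x = word w t" using x(1) by auto
  have "2 * h \<le> \<bar>word w b - x\<bar> \<or> 2 * h \<le> \<bar>word w a - x\<bar>"
    using h(2) unfolding size_of_def by linarith
  then obtain e where e: "e \<in> {a..b}" "2 * h \<le> \<bar>word w e - x\<bar>"
    using ab by (metis atLeastAtMost_iff less_imp_le order_refl)
  define q where "q = (x - x0) / h"
  have q: "x = x0 + q * h" "0 \<le> q" "q \<le> 4" using h x by (auto simp: q_def field_simps)
  show ?thesis
  proof (cases "word w e \<ge> x")
    case True
    define k where "k = \<lfloor>q\<rfloor> + 1"
    have k: "q < k" "k \<le> q + 1" "k \<in> {-1..5}" unfolding k_def using q by (simp_all; linarith)+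
    have "q * h < k * h" "k * h \<le> (q + 1) * h" using k h by (auto intro: mult_right_mono)
    then have "x < x0 + k * h" "x0 + k * h < word w e"
      using q e True h by (auto simp: distrib_right)
    then show ?thesis using k strictly_between_in_image[OF t(1) e(1)] t by blast
  next
    case False
    define k where "k = \<lceil>q\<rceil> - 1"
    have k: "k < q" "q - 1 \<le> k" "k \<in> {-1..5}" unfolding k_def using q by (simp_all; linarith)+
    have "k * h < q * h" "(q - 1) * h \<le> k * h" using k h by (auto intro: mult_right_mono)
    then have "x0 + k * h < x" "word w e < x0 + k * h"
      using q e False h by (auto simp: left_diff_distrib)
    then show ?thesis using k strictly_between_in_image[OF e(1) t(1)] t by blast
  qed
qed

text \<open>
  Every cylinder in question contains one of the seven grid points, each of which belongs to boundedly many
  of them.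
\<close>

lemma cylinders_sparse:
  "\<exists>N. \<forall>x y. x < y \<longrightarrow>
     finite {w. word w ` {a..b} \<inter> {x..y} \<noteq> {} \<and> y - x \<le> size_of w \<and> size_of w \<le> \<kappa> * (y - x)} \<and>
     card {w. word w ` {a..b} \<inter> {x..y} \<noteq> {} \<and> y - x \<le> size_of w \<and> size_of w \<le> \<kappa> * (y - x)} \<le> N"
proof -
  define X where "X l p = {w. p \<in> word w ` {a<..<b} \<and> l \<le> size_of w \<and> size_of w \<le> \<kappa> * l}" for l p
  obtain M where M: "\<And>l p. 0 < l \<Longrightarrow> finite (X l p)" "\<And>l p. 0 < l \<Longrightarrow> card (X l p) \<le> M"
    using cylinders_at_point[of \<kappa>] unfolding X_def by blast
  show ?thesis
  proof (intro exI[of _ "7 * M"] allI impI)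
    fix x y :: real assume "x < y"
    define h where "h = (y - x) / 4"
    have h: "0 < h" "4 * h = y - x" using \<open>x < y\<close> by (auto simp: h_def)
    let ?W = "{w. word w ` {a..b} \<inter> {x..y} \<noteq> {} \<and> y - x \<le> size_of w \<and> size_of w \<le> \<kappa> * (y - x)}"
    let ?V = "\<Union>k\<in>{-1..5::int}. X (y - x) (x + k * h)"
    have sub: "?W \<subseteq> ?V"
    proof
      fix w assume w: "w \<in> ?W"
      then obtain p where p: "p \<in> word w ` {a..b}" "p \<in> {x..y}" by blast
      have "\<exists>k\<in>{-1..5::int}. x + k * h \<in> word w ` {a<..<b}"
        using w p h by (intro cylinder_meets_grid[of h w p]) auto
      with w show "w \<in> ?V" by (auto simp: X_def)
    qed
    have fin: "finite ?V" using M(1) \<open>x < y\<close> by auto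
    have "card ?V \<le> (\<Sum>k\<in>{-1..5::int}. card (X (y - x) (x + k * h)))"
      by (rule card_UN_le) simp
    also have "\<dots> \<le> (\<Sum>k\<in>{-1..5::int}. M)"
      using M(2) \<open>x < y\<close> by (intro sum_mono) auto
    also have "\<dots> = 7 * M" by simp
    finally show "finite ?W \<and> card ?W \<le> 7 * M"
      using card_mono[OF fin sub] finite_subset[OF sub fin] by linarith
  qed
qed

text \<open>
  The obstacles are the images of the \<open>\<delta>\<close>-neighbourhoods of the points \<open>q j\<close> under all the words. By bounded
  distortion the radius \<open>\<eta> / (2 K)\<close> yields diameters of at most the proportion \<open>\<eta>\<close> of the cylinder.
\<close>

lemma avoiding_points_winning:
  fixes q :: "nat \<Rightarrow> real"
  assumes \<beta>: "0 < \<beta>" "\<beta> < 1"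
    and S: "\<And>x. x \<in> {a..b} \<Longrightarrow>
      (\<And>j. \<exists>\<delta>>0. \<forall>w. \<forall>t\<in>{a..b}. x = word w t \<longrightarrow> \<delta> \<le> \<bar>t - q j\<bar>) \<Longrightarrow> x \<in> S"
  shows "beta_absolute_winning \<beta> {a..b} S"
proof -
  define K where "K = distortion / (b - a)"
  have K: "0 < K" using distortion_pos ab by (simp add: K_def)
  define U where "U j w \<eta> = {word w t |t. t \<in> {a..b} \<and> \<bar>t - q j\<bar> < \<eta> / (2 * K)}" for j w \<eta>
  show ?thesis
  proof (rule beta_absolute_winning_if_sparse_obstacles[where U = U and C = "\<lambda>w. word w ` {a..b}"
        and m = size_of and ?m0.0 = "b - a", OF \<beta> size_pos size_le])
    show "U j w \<eta> \<subseteq> word w ` {a..b}" for j w \<eta> by (auto simp: U_def)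
  next
    fix j w \<eta> x y assume \<eta>: "0 < \<eta>" and "x \<in> U j w \<eta>" "y \<in> U j w \<eta>"
    then obtain s t where s: "s \<in> {a..b}" "x = word w s" "\<bar>s - q j\<bar> < \<eta> / (2 * K)"
      and t: "t \<in> {a..b}" "y = word w t" "\<bar>t - q j\<bar> < \<eta> / (2 * K)"
      by (auto simp: U_def)
    have "\<bar>s - t\<bar> \<le> \<eta> / (2 * K) + \<eta> / (2 * K)" using s(3) t(3) by linarith
    also have "\<dots> = \<eta> / K" using K by (simp add: field_simps)
    finally have "K * \<bar>s - t\<bar> \<le> \<eta>" using K by (simp add: field_simps)
    then have "K * \<bar>s - t\<bar> * size_of w \<le> \<eta> * size_of w"
      using size_pos[of w] by (intro mult_right_mono) auto
    then show "\<bar>x - y\<bar> \<le> \<eta> * size_of w"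
      using word_proportion[OF s(1) t(1), of w] s(2) t(2) by (simp add: K_def)
  next
    show "\<exists>N. \<forall>x y. x < y \<longrightarrow>
        finite {w. word w ` {a..b} \<inter> {x..y} \<noteq> {} \<and> y - x \<le> size_of w \<and> size_of w \<le> \<kappa> * (y - x)} \<and>
        card {w. word w ` {a..b} \<inter> {x..y} \<noteq> {} \<and> y - x \<le> size_of w \<and> size_of w \<le> \<kappa> * (y - x)} \<le> N"
      for \<kappa>
      by (rule cylinders_sparse)
  next
    fix x assume x: "x \<in> {a..b}" and avoid: "\<And>j. \<exists>\<eta>>0. \<forall>w. x \<notin> U j w \<eta>"
    show "x \<in> S"
    proof (rule S[OF x])
      fix j
      obtain \<eta> where "0 < \<eta>" "\<And>w. x \<notin> U j w \<eta>" using avoid by blast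
      then show "\<exists>\<delta>>0. \<forall>w. \<forall>t\<in>{a..b}. x = word w t \<longrightarrow> \<delta> \<le> \<bar>t - q j\<bar>"
        using K by (intro exI[of _ "\<eta> / (2 * K)"]) (fastforce simp: U_def not_less)
    qed
  qed
qed

end

section \<open>Distortion of the iterates of a neutral inverse branch\<close>

lemma powr_comparable:
  fixes u v e \<Lambda> :: real
  assumes "0 < u" "0 < v" "u \<le> \<Lambda> * v" "v \<le> \<Lambda> * u"
  shows "u powr e \<le> \<Lambda> powr \<bar>e\<bar> * v powr e"
proof -
  have \<Lambda>: "0 < \<Lambda>" using assms by (metis less_le_trans zero_less_mult_pos2)
  show ?thesis
  proof (cases "0 \<le> e")
    case True
    then have "u powr e \<le> (\<Lambda> * v) powr e" using assms by (intro powr_mono2) auto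
    then show ?thesis using True assms \<Lambda> by (simp add: powr_mult)
  next
    case False
    have "u powr e \<le> (v / \<Lambda>) powr e"
      using False assms \<Lambda> by (intro powr_mono2') (auto simp: field_simps)
    also have "\<dots> = \<Lambda> powr \<bar>e\<bar> * v powr e"
      using False assms \<Lambda> by (simp add: powr_divide powr_minus_divide)
    finally show ?thesis .
  qed
qed

text \<open>
  The map \<open>h\<close> is the inverse of an increasing branch on \<open>[0, r]\<close> with derivative \<open>D\<close>, which is expanding except
  possibly at \<open>0\<close>, and \<open>D2\<close> is the second derivative. The bound \<open>y \<le> \<Lambda> * h y\<close> says that the branch expands the distance
  to \<open>0\<close> by at most \<open>\<Lambda>\<close>. The aim is a Lipschitz bound, uniform in \<open>k\<close>, on the logarithm of the derivative of
  \<open>h ^^ k\<close> on \<open>(r, 1)\<close>.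
\<close>

locale neutral_inverse_branch =
  fixes h D D2 :: "real \<Rightarrow> real" and r \<Lambda> C \<gamma> :: real
  assumes r: "0 < r" "r < 1" and C: "1 \<le> C"
    and h_in: "\<And>y. y \<in> {0<..<1} \<Longrightarrow> h y \<in> {0<..<r}"
    and h_deriv: "\<And>y. y \<in> {0<..<1} \<Longrightarrow> (h has_real_derivative inverse (D (h y))) (at y)"
    and h_ge: "\<And>y. y \<in> {0<..<1} \<Longrightarrow> y \<le> \<Lambda> * h y"
    and D_gt: "\<And>x. x \<in> {0<..<r} \<Longrightarrow> 1 < D x"
    and D_le: "\<And>x. x \<in> {0<..<r} \<Longrightarrow> D x \<le> \<Lambda>"
    and D_deriv: "\<And>x. x \<in> {0<..<r} \<Longrightarrow> (D has_real_derivative D2 x) (at x)"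
    and D2_ge: "\<And>x. x \<in> {0<..<r} \<Longrightarrow> inverse C * x powr (\<gamma> - 1) \<le> D2 x"
    and D2_le: "\<And>x. x \<in> {0<..<r} \<Longrightarrow> D2 x \<le> C * x powr (\<gamma> - 1)"
begin

definition iter_deriv :: "nat \<Rightarrow> real \<Rightarrow> real" where
  "iter_deriv k y = (\<Prod>i<k. inverse (D ((h ^^ Suc i) y)))"

lemma \<Lambda>: "1 \<le> \<Lambda>"
proof -
  have "r / 2 \<in> {0<..<r}" using r by auto
  then show ?thesis using D_gt D_le by (meson less_imp_le order_trans)
qed

lemma iter_in: "y \<in> {0<..<1} \<Longrightarrow> (h ^^ k) y \<in> {0<..<1}"
proof (induction k)
  case (Suc k)
  then show ?case using h_in[of "(h ^^ k) y"] r by auto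
qed simp

lemma iter_Suc_in: "y \<in> {0<..<1} \<Longrightarrow> (h ^^ Suc k) y \<in> {0<..<r}"
  using h_in[OF iter_in[of y k]] by simp

lemma iter_has_deriv: "y \<in> {0<..<1} \<Longrightarrow> ((h ^^ k) has_real_derivative iter_deriv k y) (at y)"
proof (induction k)
  case (Suc k)
  have "((\<lambda>x. h ((h ^^ k) x)) has_real_derivative inverse (D (h ((h ^^ k) y))) * iter_deriv k y) (at y)"
    by (rule DERIV_chain2[OF h_deriv[OF iter_in[OF Suc.prems]] Suc.IH[OF Suc.prems]])
  then show ?case by (simp add: iter_deriv_def o_def mult.commute)
qed (simp add: iter_deriv_def id_def)

lemma iter_deriv_bounds:
  assumes "y \<in> {0<..<1}"
  shows "0 < iter_deriv k y" "iter_deriv k y \<le> 1"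
proof -
  have "0 < inverse (D ((h ^^ Suc i) y)) \<and> inverse (D ((h ^^ Suc i) y)) \<le> 1" for i
    using D_gt[OF iter_Suc_in[OF assms, of i]] by (simp add: inverse_le_1_iff)
  then show "0 < iter_deriv k y" "iter_deriv k y \<le> 1"
    unfolding iter_deriv_def by (auto intro!: prod_pos prod_le_1 simp: less_imp_le simp del: funpow.simps)
qed

lemma iter_mvt:
  assumes "x \<in> {0<..<1}" "y \<in> {0<..<1}" "x < y"
  shows "\<exists>t. x < t \<and> t < y \<and> (h ^^ k) y - (h ^^ k) x = iter_deriv k t * (y - x)"
proof (rule mean_value[OF assms(3)])
  show "continuous_on {x..y} (h ^^ k)"
    using assms by (auto intro!: DERIV_continuous_on[of _ _ "iter_deriv k"]
        has_field_derivative_at_within iter_has_deriv)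
qed (use assms in \<open>auto intro!: iter_has_deriv\<close>)

lemma iter_strict_mono:
  assumes "x \<in> {0<..<1}" "y \<in> {0<..<1}" "x < y"
  shows "(h ^^ k) x < (h ^^ k) y"
proof -
  from iter_mvt[OF assms, of k] obtain t where "x < t" "t < y"
    "(h ^^ k) y - (h ^^ k) x = iter_deriv k t * (y - x)" by blast
  moreover have "0 < iter_deriv k t * (y - x)"
    using iter_deriv_bounds(1)[of t k] assms calculation by (intro mult_pos_pos) auto
  ultimately show ?thesis by linarith
qed

lemma iter_mono: "x \<in> {0<..<1} \<Longrightarrow> y \<in> {0<..<1} \<Longrightarrow> x \<le> y \<Longrightarrow> (h ^^ k) x \<le> (h ^^ k) y"
  using iter_strict_mono[of x y k] by (cases "x = y") auto

lemma D2_pos: "x \<in> {0<..<r} \<Longrightarrow> 0 < D2 x"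
proof -
  assume x: "x \<in> {0<..<r}"
  have "0 < inverse C * x powr (\<gamma> - 1)" using C x by auto
  then show ?thesis using D2_ge[OF x] by linarith
qed

lemma D_mvt:
  assumes "x \<in> {0<..<r}" "y \<in> {0<..<r}" "x < y"
  shows "\<exists>t. x < t \<and> t < y \<and> D y - D x = D2 t * (y - x)"
proof (rule mean_value[OF assms(3)])
  show "continuous_on {x..y} D"
    using assms by (auto intro!: DERIV_continuous_on[of _ _ D2] has_field_derivative_at_within D_deriv)
qed (use assms in \<open>auto intro!: D_deriv\<close>)

lemma D_mono:
  assumes "x \<in> {0<..<r}" "y \<in> {0<..<r}" "x \<le> y"
  shows "D x \<le> D y"
proof (cases "x = y")
  case False
  then have "x < y" using assms by simp
  from D_mvt[OF assms(1,2) this] obtain t where "x < t" "t < y" "D y - D x = D2 t * (y - x)" by blast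
  then show ?thesis using D2_pos[of t] assms by (metis greaterThanLessThan_iff diff_ge_0_iff_ge
        less_imp_le mult_nonneg_nonneg order_less_trans)
qed simp

text \<open>
  The images of \<open>[r, c]\<close> under the iterates of \<open>h\<close> are disjoint; this is what makes the sums below telescope. The
  auxiliary point \<open>c < 1\<close> in place of \<open>1\<close> avoids the derivative of the branch at its end point \<open>r = h 1\<close>.
\<close>

lemma iter_step_below:
  assumes "c \<in> {0<..<1}"
  shows "(h ^^ Suc k) c < (h ^^ k) r"
proof -
  have "(h ^^ k) (h c) < (h ^^ k) r"
    using h_in[OF assms] r by (intro iter_strict_mono) auto
  then show ?thesis by (simp add: funpow_swap1)
qed

context
  fixes c :: real
  assumes c: "r < c" "c < 1"
begin

lemma in_unit: "x \<in> {r..c} \<Longrightarrow> x \<in> {0<..<1}"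
  using r c by auto

text \<open>
  A first, crude distortion bound: since \<open>D\<close> is increasing, \<open>D\<close> at \<open>(h ^^ i) r\<close> is at least \<open>D\<close> at the next
  point \<open>(h ^^ Suc i) c\<close>, and the product of the ratios collapses.
\<close>

lemma iter_deriv_telescope:
  "iter_deriv k r \<le> D (h c) / D ((h ^^ Suc k) c) * iter_deriv k c"
proof (induction k)
  case 0
  have "1 < D (h c)" using in_unit[of c] c by (intro D_gt h_in) auto
  then show ?case by (simp add: iter_deriv_def)
next
  case (Suc k)
  let ?x = "(h ^^ Suc (Suc k)) c" and ?y = "(h ^^ Suc k) r" and ?z = "(h ^^ Suc k) c"
  have in0: "?x \<in> {0<..<r}" "?y \<in> {0<..<r}" "?z \<in> {0<..<r}" "h c \<in> {0<..<r}"
    using in_unit[of c] in_unit[of r] c by (auto intro!: iter_Suc_in h_in simp del: funpow.simps greaterThanLessThan_iff)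
  have "D ?x \<le> D ?y"
    using in0 iter_step_below[of c "Suc k"] in_unit[of c] c by (intro D_mono) (auto simp del: funpow.simps)
  then have inv: "inverse (D ?y) \<le> inverse (D ?x)"
    using D_gt[OF in0(1)] by (intro le_imp_inverse_le) auto
  have pos: "0 < D ?x" "0 < D (h c)" "0 < D ?z" "0 < iter_deriv k c"
    using D_gt[OF in0(1)] D_gt[OF in0(4)] D_gt[OF in0(3)] iter_deriv_bounds(1)[of c k] in_unit[of c] c by auto
  have "iter_deriv (Suc k) r = inverse (D ?y) * iter_deriv k r"
    by (simp add: iter_deriv_def mult.commute)
  also have "\<dots> \<le> inverse (D ?x) * (D (h c) / D ?z * iter_deriv k c)"
    using inv Suc.IH pos iter_deriv_bounds(1)[of r k] in_unit[of r] c
    by (intro mult_mono) (auto simp del: funpow.simps simp: less_imp_le)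
  also have "\<dots> = D (h c) / D ?x * iter_deriv (Suc k) c"
    by (simp add: iter_deriv_def divide_inverse mult_ac)
  finally show ?case .
qed

lemma iter_deriv_antimono:
  assumes "x \<in> {r..c}" "y \<in> {r..c}" "x \<le> y"
  shows "iter_deriv k y \<le> iter_deriv k x"
  unfolding iter_deriv_def
proof (intro prod_mono conjI)
  fix i
  have in0: "(h ^^ Suc i) x \<in> {0<..<r}" "(h ^^ Suc i) y \<in> {0<..<r}"
    using in_unit assms by (auto intro!: iter_Suc_in simp del: funpow.simps greaterThanLessThan_iff)
  show "0 \<le> inverse (D ((h ^^ Suc i) y))" using D_gt[OF in0(2)] by (simp del: funpow.simps)
  have "D ((h ^^ Suc i) x) \<le> D ((h ^^ Suc i) y)"
    using in0 assms in_unit by (intro D_mono iter_mono) auto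
  then show "inverse (D ((h ^^ Suc i) y)) \<le> inverse (D ((h ^^ Suc i) x))"
    using D_gt[OF in0(1)] by (intro le_imp_inverse_le) auto
qed

lemma iter_deriv_comparable:
  assumes "x \<in> {r..c}" "y \<in> {r..c}"
  shows "iter_deriv k x \<le> \<Lambda> * iter_deriv k y"
proof -
  have in0: "h c \<in> {0<..<r}" "(h ^^ Suc k) c \<in> {0<..<r}"
    using in_unit[of c] c by (auto intro!: iter_Suc_in h_in simp del: funpow.simps greaterThanLessThan_iff)
  have "iter_deriv k x \<le> iter_deriv k r"
    using assms by (intro iter_deriv_antimono) auto
  also have "\<dots> \<le> D (h c) / D ((h ^^ Suc k) c) * iter_deriv k c" by (rule iter_deriv_telescope)
  also have "\<dots> \<le> \<Lambda> * iter_deriv k y"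
  proof (intro mult_mono)
    have "D (h c) / D ((h ^^ Suc k) c) \<le> D (h c) / 1"
      using D_gt[OF in0(1)] D_gt[OF in0(2)] by (intro divide_left_mono) (auto simp del: funpow.simps)
    then show "D (h c) / D ((h ^^ Suc k) c) \<le> \<Lambda>" using D_le[OF in0(1)] by (simp del: funpow.simps)
    show "iter_deriv k c \<le> iter_deriv k y" using assms by (intro iter_deriv_antimono) auto
  qed (use \<Lambda> iter_deriv_bounds(1)[OF in_unit[of c], of k] c in \<open>auto simp: less_imp_le\<close>)
  finally show ?thesis .
qed

text \<open>
  By the crude bound, the iterates preserve proportions of lengths up to the factor \<open>\<Lambda>\<close>.
\<close>

lemma iter_proportion:
  assumes "x \<in> {r..c}" "y \<in> {r..c}" "x < y"
  shows "(h ^^ k) y - (h ^^ k) x \<le> \<Lambda> / (c - r) * (y - x) * ((h ^^ k) c - (h ^^ k) r)"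
proof -
  obtain t where t: "x < t" "t < y" "(h ^^ k) y - (h ^^ k) x = iter_deriv k t * (y - x)"
    using iter_mvt[OF in_unit in_unit] assms by blast
  obtain s where s: "r < s" "s < c" "(h ^^ k) c - (h ^^ k) r = iter_deriv k s * (c - r)"
    using iter_mvt[OF in_unit in_unit, of r c] c by auto
  have "iter_deriv k t * (y - x) \<le> \<Lambda> * iter_deriv k s * (y - x)"
    using iter_deriv_comparable[of t s k] t s assms by (intro mult_right_mono) auto
  also have "\<dots> = \<Lambda> / (c - r) * (y - x) * (iter_deriv k s * (c - r))" using c by simp
  finally show ?thesis unfolding t(3) s(3) .
qed

definition variation_bound :: real where
  "variation_bound = C\<^sup>2 * \<Lambda> powr \<bar>\<gamma> - 1\<bar> * (\<Lambda> / (c - r))"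

text \<open>
  On the interval \<open>[(h ^^ Suc k) r, (h ^^ Suc k) c]\<close> the quotient of any two points is at most \<open>\<Lambda>\<close>, so by the
  growth condition \<open>D2\<close> is constant up to a factor there. Hence the increment of \<open>D\<close> over a subinterval is
  controlled by the proportion of that subinterval times the increment over the whole interval.
\<close>

lemma D_variation:
  assumes "x \<in> {r..c}" "y \<in> {r..c}" "x < y"
  shows "D ((h ^^ Suc k) y) - D ((h ^^ Suc k) x)
    \<le> variation_bound * (y - x) * (D ((h ^^ Suc k) c) - D ((h ^^ Suc k) r))"
proof -
  let ?h = "h ^^ Suc k"
  have in0: "?h z \<in> {0<..<r}" if "z \<in> {r..c}" for z
    using in_unit[OF that] by (rule iter_Suc_in)
  have rc: "r \<in> {r..c}" "c \<in> {r..c}" using c by auto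
  have lt: "?h x < ?h y" "?h r < ?h c" "?h r \<le> ?h x" "?h y \<le> ?h c"
    using assms rc c in_unit by (auto intro!: iter_strict_mono iter_mono simp del: funpow.simps)
  obtain u where u: "?h x < u" "u < ?h y" "D (?h y) - D (?h x) = D2 u * (?h y - ?h x)"
    using D_mvt[OF in0[OF assms(1)] in0[OF assms(2)] lt(1)] by blast
  obtain v where v: "?h r < v" "v < ?h c" "D (?h c) - D (?h r) = D2 v * (?h c - ?h r)"
    using D_mvt[OF in0[OF rc(1)] in0[OF rc(2)] lt(2)] by blast
  have "?h c \<le> (h ^^ k) r" using iter_step_below[OF in_unit[OF rc(2)], of k] by simp
  also have "\<dots> \<le> \<Lambda> * ?h r" using h_ge[OF iter_in[OF in_unit[OF rc(1)]], of k] by simp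
  finally have hc: "?h c \<le> \<Lambda> * ?h r" .
  have uv: "?h r \<le> u" "u \<le> ?h c" "?h r \<le> v" "v \<le> ?h c" using u v lt by linarith+
  have pos: "0 < ?h r" "?h c < r" using in0[OF rc(1)] in0[OF rc(2)] by (auto simp del: funpow.simps)
  have uv0: "0 < u" "0 < v" "u < r" "v < r" using uv pos by linarith+
  have "\<Lambda> * ?h r \<le> \<Lambda> * v" "\<Lambda> * ?h r \<le> \<Lambda> * u" using uv \<Lambda> by (auto intro!: mult_left_mono simp del: funpow.simps)
  then have uv1: "u \<le> \<Lambda> * v" "v \<le> \<Lambda> * u" using uv hc by linarith+
  have "D2 u \<le> C * u powr (\<gamma> - 1)" using uv0 by (intro D2_le) auto
  also have "\<dots> \<le> C * (\<Lambda> powr \<bar>\<gamma> - 1\<bar> * v powr (\<gamma> - 1))"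
    using powr_comparable[OF uv0(1,2) uv1] C by (intro mult_left_mono) auto
  also have "\<dots> = C\<^sup>2 * \<Lambda> powr \<bar>\<gamma> - 1\<bar> * (inverse C * v powr (\<gamma> - 1))"
    using C by (simp add: power2_eq_square)
  also have "\<dots> \<le> C\<^sup>2 * \<Lambda> powr \<bar>\<gamma> - 1\<bar> * D2 v"
    using D2_ge[of v] uv0 by (intro mult_left_mono) auto
  finally have "D2 u * (?h y - ?h x) \<le> (C\<^sup>2 * \<Lambda> powr \<bar>\<gamma> - 1\<bar> * D2 v) *
      (\<Lambda> / (c - r) * (y - x) * (?h c - ?h r))"
    using iter_proportion[OF assms, of "Suc k"] lt D2_pos[of v] uv0 by (intro mult_mono) auto
  then show ?thesis unfolding u(3) v(3) variation_bound_def by (simp only: mult_ac)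
qed

text \<open>
  The increments of \<open>D\<close> over the disjoint intervals of the orbit add up to at most the total variation of the
  bounded increasing function \<open>D\<close>.
\<close>

lemma D_variation_sum:
  assumes "x \<in> {r..c}" "y \<in> {r..c}" "x < y"
  shows "(\<Sum>i<k. D ((h ^^ Suc i) y) - D ((h ^^ Suc i) x)) \<le> variation_bound * \<Lambda> * (y - x)"
proof -
  have rc: "r \<in> {r..c}" "c \<in> {r..c}" using c by auto
  have in0: "(h ^^ Suc i) z \<in> {0<..<r}" if "z \<in> {r..c}" for i z
    using in_unit[OF that] by (rule iter_Suc_in)
  have V: "0 \<le> variation_bound" using C \<Lambda> c by (simp add: variation_bound_def)
  have "(\<Sum>i<k. D ((h ^^ Suc i) c) - D ((h ^^ Suc i) r))
      \<le> (\<Sum>i<k. D ((h ^^ Suc i) c) - D ((h ^^ Suc (Suc i)) c))"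
  proof (intro sum_mono diff_left_mono D_mono)
    fix i show "(h ^^ Suc (Suc i)) c \<le> (h ^^ Suc i) r"
      using iter_step_below[OF in_unit[OF rc(2)], of "Suc i"] by simp
  qed (use in0 rc in blast)+
  also have "\<dots> = D ((h ^^ Suc 0) c) - D ((h ^^ Suc k) c)"
    by (rule sum_lessThan_telescope'[of "\<lambda>i. D ((h ^^ Suc i) c)"])
  also have "\<dots> \<le> \<Lambda>"
    using D_le[OF in0[OF rc(2), of 0]] D_gt[OF in0[OF rc(2), of k]] by linarith
  finally have tele: "(\<Sum>i<k. D ((h ^^ Suc i) c) - D ((h ^^ Suc i) r)) \<le> \<Lambda>" .
  have "(\<Sum>i<k. D ((h ^^ Suc i) y) - D ((h ^^ Suc i) x))
      \<le> (\<Sum>i<k. variation_bound * (y - x) * (D ((h ^^ Suc i) c) - D ((h ^^ Suc i) r)))"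
    by (intro sum_mono D_variation assms)
  also have "\<dots> = variation_bound * (y - x) * (\<Sum>i<k. D ((h ^^ Suc i) c) - D ((h ^^ Suc i) r))"
    by (simp only: sum_distrib_left)
  also have "\<dots> \<le> variation_bound * (y - x) * \<Lambda>"
    using tele V assms(3) by (intro mult_left_mono) auto
  finally show ?thesis by (simp only: mult_ac)
qed

text \<open>
  As \<open>D > 1\<close>, the quotient of two values of \<open>D\<close> is at most the exponential of their difference.
\<close>

lemma iter_deriv_distortion_below:
  assumes "x \<in> {r..c}" "y \<in> {r..c}" "x < y"
  shows "iter_deriv k x \<le> exp (variation_bound * \<Lambda> * (y - x)) * iter_deriv k y"
proof -
  have "iter_deriv k x \<le> (\<Prod>i<k. exp (D ((h ^^ Suc i) y) - D ((h ^^ Suc i) x)) * inverse (D ((h ^^ Suc i) y)))"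
    unfolding iter_deriv_def
  proof (intro prod_mono conjI)
    fix i
    let ?p = "D ((h ^^ Suc i) x)" and ?q = "D ((h ^^ Suc i) y)"
    have in0: "(h ^^ Suc i) x \<in> {0<..<r}" "(h ^^ Suc i) y \<in> {0<..<r}"
      using in_unit assms by (auto intro!: iter_Suc_in simp del: funpow.simps greaterThanLessThan_iff)
    have pq: "1 < ?p" "1 < ?q" using D_gt in0 by blast+
    have le: "?p \<le> ?q" using in0 assms in_unit by (intro D_mono iter_mono) auto
    show "0 \<le> inverse ?p" using pq by simp
    have "?q / ?p = 1 + (?q - ?p) / ?p" using pq by (simp add: field_simps)
    also have "\<dots> \<le> 1 + (?q - ?p) / 1" using le pq by (intro add_left_mono divide_left_mono) auto
    also have "\<dots> = 1 + (?q - ?p)" by simp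
    also have "\<dots> \<le> exp (?q - ?p)" by (rule exp_ge_add_one_self)
    finally have "?q / ?p \<le> exp (?q - ?p)" .
    then show "inverse ?p \<le> exp (?q - ?p) * inverse ?q" using pq by (simp add: field_simps)
  qed
  also have "\<dots> = exp (\<Sum>i<k. D ((h ^^ Suc i) y) - D ((h ^^ Suc i) x)) * iter_deriv k y"
    by (simp only: prod.distrib exp_sum finite_lessThan iter_deriv_def)
  also have "\<dots> \<le> exp (variation_bound * \<Lambda> * (y - x)) * iter_deriv k y"
    using D_variation_sum[OF assms, of k] iter_deriv_bounds(1)[OF in_unit[OF assms(2)], of k]
    by (intro mult_right_mono) (auto simp del: funpow.simps)
  finally show ?thesis .
qed

end

text \<open>
  The point \<open>c\<close> lies above both \<open>x\<close> and \<open>y\<close> and at distance at least \<open>(1 - r) / 2\<close> from \<open>r\<close>, so that the constants remain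
  bounded.
\<close>

lemma iter_deriv_distortion:
  "\<exists>L\<ge>0. \<forall>k. \<forall>x\<in>{r<..<1}. \<forall>y\<in>{r<..<1}. iter_deriv k x \<le> exp (L * \<bar>x - y\<bar>) * iter_deriv k y"
proof -
  define V where "V = C\<^sup>2 * \<Lambda> powr \<bar>\<gamma> - 1\<bar> * (\<Lambda> / ((1 - r) / 2))"
  have V: "0 \<le> V" using C \<Lambda> r by (simp add: V_def)
  show ?thesis
  proof (intro exI[of _ "V * \<Lambda>"] conjI allI ballI)
    show "0 \<le> V * \<Lambda>" using V \<Lambda> by simp
    fix k x y assume xy: "x \<in> {r<..<1}" "y \<in> {r<..<1}"
    define c where "c = max ((1 + r) / 2) (max x y)"
    have c: "r < c" "c < 1" "(1 - r) / 2 \<le> c - r" "x \<in> {r..c}" "y \<in> {r..c}"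
      using r xy by (auto simp: c_def max_def field_simps)
    have "variation_bound c \<le> V"
      unfolding variation_bound_def[OF c(1,2)] V_def using C \<Lambda> c r
      by (intro mult_left_mono divide_left_mono mult_pos_pos) auto
    then have e: "1 \<le> exp (V * \<Lambda> * \<bar>x - y\<bar>)"
      "variation_bound c * \<Lambda> * \<bar>x - y\<bar> \<le> V * \<Lambda> * \<bar>x - y\<bar>"
      using V \<Lambda> by (auto intro!: mult_right_mono)
    have pos: "0 < iter_deriv k y" using xy r by (intro iter_deriv_bounds) auto
    consider "x < y" | "y \<le> x" by linarith
    then show "iter_deriv k x \<le> exp (V * \<Lambda> * \<bar>x - y\<bar>) * iter_deriv k y"
    proof cases
      case 1
      have "iter_deriv k x \<le> exp (variation_bound c * \<Lambda> * (y - x)) * iter_deriv k y"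
        by (rule iter_deriv_distortion_below[OF c(1,2,4,5) 1])
      also have "\<dots> \<le> exp (V * \<Lambda> * \<bar>x - y\<bar>) * iter_deriv k y"
        using e(2) pos 1 by (intro mult_right_mono) auto
      finally show ?thesis .
    next
      case 2
      have "iter_deriv k x \<le> 1 * iter_deriv k y"
        using iter_deriv_antimono[OF c(1,2,5,4) 2, of k] by simp
      also have "\<dots> \<le> exp (V * \<Lambda> * \<bar>x - y\<bar>) * iter_deriv k y"
        using e(1) pos by (intro mult_right_mono) auto
      finally show ?thesis .
    qed
  qed
qed

end

section \<open>The two branches of a Manneville--Pomeau type map\<close>

lemma deriv_on_interior: "x \<in> interior S \<Longrightarrow> deriv_on S g x = deriv g x"
  by (simp only: deriv_on_def at_within_interior field_derivative_eq_vector_derivative)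

lemma C1_on_has_deriv:
  assumes "C1_on S g" "x \<in> interior S"
  shows "(g has_real_derivative deriv g x) (at x)"
proof -
  have "g differentiable (at x within S)" using assms interior_subset by (auto simp: C1_on_def)
  then show ?thesis
    unfolding DERIV_deriv_iff_real_differentiable at_within_interior[OF assms(2)] .
qed

lemma C2_on_has_second_deriv:
  assumes "C2_on S g" "x \<in> interior S"
  shows "(deriv g has_real_derivative deriv_on S (deriv_on S g) x) (at x)"
proof -
  have "(deriv_on S g has_real_derivative deriv_on S (deriv_on S g) x) (at x)"
    using C1_on_has_deriv[of S "deriv_on S g" x] assms
    unfolding C2_on_def deriv_on_interior[OF assms(2)] by blast
  then show ?thesis
    by (rule has_field_derivative_transform_within_open[OF _ open_interior assms(2)])
       (rule deriv_on_interior)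
qed

text \<open>
  A branch is injective by Rolle's theorem, and as a continuous function on a compact interval it maps the closed
  interval onto \<open>[0, 1]\<close>; no orientation has to be distinguished.
\<close>

lemma branch_inverse:
  fixes \<phi> \<phi>' :: "real \<Rightarrow> real"
  assumes lu: "l < u" and cont: "continuous_on {l..u} \<phi>"
    and der: "\<And>x. x \<in> {l<..<u} \<Longrightarrow> (\<phi> has_real_derivative \<phi>' x) (at x)"
    and nz: "\<And>x. x \<in> {l<..<u} \<Longrightarrow> \<phi>' x \<noteq> 0"
    and onto: "\<phi> ` {l<..<u} = {0<..<1}"
  obtains h where "continuous_on {0..1} h"
    and "\<And>x. x \<in> {l..u} \<Longrightarrow> h (\<phi> x) = x"
    and "\<And>y. y \<in> {0..1} \<Longrightarrow> h y \<in> {l..u} \<and> \<phi> (h y) = y"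
    and "\<And>y. y \<in> {0<..<1} \<Longrightarrow> h y \<in> {l<..<u} \<and> (h has_real_derivative inverse (\<phi>' (h y))) (at y)"
proof -
  have inj: "inj_on \<phi> {l..u}"
  proof (rule inj_onI, rule ccontr)
    fix x y assume xy: "x \<in> {l..u}" "y \<in> {l..u}" "\<phi> x = \<phi> y" "x \<noteq> y"
    from mean_value_abs[OF xy(1,2,4) cont der] obtain t
      where "t \<in> {l<..<u}" "\<bar>\<phi> x - \<phi> y\<bar> = \<bar>\<phi>' t\<bar> * \<bar>x - y\<bar>" by blast
    then show False using nz[of t] xy(3,4) by auto
  qed
  have img: "\<phi> ` {l..u} = {0..1}"
  proof
    have "\<phi> ` closure {l<..<u} \<subseteq> {0..1}"
    proof (rule image_closure_subset)
      show "continuous_on (closure {l<..<u}) \<phi>" using cont lu by simp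
      show "\<phi> ` {l<..<u} \<subseteq> {0..1}" unfolding onto by auto
    qed simp
    then show "\<phi> ` {l..u} \<subseteq> {0..1}" using lu by simp
    have "closed (\<phi> ` {l..u})"
      using cont by (intro compact_imp_closed compact_continuous_image) auto
    moreover have "{0<..<1} \<subseteq> \<phi> ` {l..u}" unfolding onto[symmetric] by auto
    ultimately have "closure {0<..<1} \<subseteq> \<phi> ` {l..u}" by (intro closure_minimal)
    then show "{0..1} \<subseteq> \<phi> ` {l..u}" by simp
  qed
  define h where "h = the_inv_into {l..u} \<phi>"
  have h1: "h (\<phi> x) = x" if "x \<in> {l..u}" for x
    unfolding h_def by (rule the_inv_into_f_f[OF inj that])
  have h2: "h y \<in> {l..u} \<and> \<phi> (h y) = y" if "y \<in> {0..1}" for y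
    using that h1 unfolding img[symmetric] by auto
  have h3: "continuous_on {0..1} h"
    unfolding h_def img[symmetric] by (rule continuous_on_inv_into[OF cont _ inj]) simp
  have h4: "h y \<in> {l<..<u} \<and> (h has_real_derivative inverse (\<phi>' (h y))) (at y)" if y: "y \<in> {0<..<1}" for y
  proof
    obtain x where x: "x \<in> {l<..<u}" "\<phi> x = y" using y unfolding onto[symmetric] by auto
    then show *: "h y \<in> {l<..<u}" using h1[of x] by auto
    show "(h has_real_derivative inverse (\<phi>' (h y))) (at y)"
    proof (rule DERIV_inverse_function[where f = \<phi> and a = 0 and b = 1])
      show "isCont h y"
        using continuous_on_interior[OF h3, of y] y by simp
    qed (use * der nz y h2 in auto)
  qed
  show thesis using that[OF h3 h1 h2 h4] by blast
qed

text \<open>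
  The derivative of the left branch is positive: it is at least \<open>1\<close> in absolute value, it is close to \<open>1\<close> near the
  neutral fixed point, and it increases because the second derivative is positive.
\<close>

lemma left_branch_regular:
  assumes mp: "manneville_pomeau f r"
  defines "D2 \<equiv> deriv_on {0<..<r} (deriv_on {0<..<r} f)"
  obtains \<Lambda> C \<gamma> where "1 \<le> C" and "continuous_on {0..r} (left_branch f r)"
    and "\<And>x. x \<in> {0<..<r} \<Longrightarrow> (left_branch f r has_real_derivative deriv f x) (at x)"
    and "\<And>x. x \<in> {0<..<r} \<Longrightarrow> 1 < deriv f x" and "\<And>x. x \<in> {0<..<r} \<Longrightarrow> deriv f x \<le> \<Lambda>"
    and "\<And>x. x \<in> {0<..<r} \<Longrightarrow> (deriv f has_real_derivative D2 x) (at x)"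
    and "\<And>x. x \<in> {0<..<r} \<Longrightarrow> inverse C * x powr (\<gamma> - 1) \<le> D2 x"
    and "\<And>x. x \<in> {0<..<r} \<Longrightarrow> D2 x \<le> C * x powr (\<gamma> - 1)"
proof -
  let ?\<phi> = "left_branch f r"
  have r: "0 < r" and C1: "C1_on {0..<r} f" and C2: "C2_on {0<..<r} f"
    and dr: "?\<phi> differentiable (at r within {0..r})" and d0: "deriv_on {0..<r} f 0 = 1"
    and gt1: "\<And>x. x \<in> {0<..r} \<Longrightarrow> 1 < \<bar>deriv_on {0..r} ?\<phi> x\<bar>"
    and bdd: "bdd_above ((\<lambda>x. \<bar>deriv_on {0..r} ?\<phi> x\<bar>) ` {0..r})"
    using mp by (auto simp: manneville_pomeau_def)
  obtain C \<gamma> where C: "1 \<le> C" and growth: "\<And>x. x \<in> {0<..<r} \<Longrightarrow>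
      inverse C \<le> D2 x / x powr (\<gamma> - 1) \<and> D2 x / x powr (\<gamma> - 1) \<le> C"
    using mp unfolding manneville_pomeau_def D2_def by blast
  obtain \<Lambda> where \<Lambda>: "\<And>x. x \<in> {0..r} \<Longrightarrow> \<bar>deriv_on {0..r} ?\<phi> x\<bar> \<le> \<Lambda>"
    using bdd unfolding bdd_above_def by (meson imageI)
  have cont: "continuous_on {0..r} ?\<phi>"
    unfolding continuous_on_eq_continuous_within
  proof
    fix x assume x: "x \<in> {0..r}"
    show "continuous (at x within {0..r}) ?\<phi>"
    proof (cases "x = r")
      case True
      then show ?thesis using differentiable_imp_continuous_within[OF dr] by simp
    next
      case False
      then have x: "x \<in> {0..<r}" using x by auto
      have "f differentiable (at x within {0..<r})" using C1 x by (simp add: C1_on_def)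
      then have "continuous (at x within {0..<r}) f" by (rule differentiable_imp_continuous_within)
      then have "continuous (at x within {0..<r}) ?\<phi>"
        by (rule continuous_transform_within[where \<delta> = 1]) (use x in \<open>auto simp: left_branch_def\<close>)
      moreover have "at x within {0..r} = at x within {0..<r}"
        using x by (intro at_within_nhd[of x "{..<r}"]) auto
      ultimately show ?thesis by simp
    qed
  qed
  have der: "(f has_real_derivative deriv f x) (at x)" if "x \<in> {0<..<r}" for x
    using C1_on_has_deriv[of "{0<..<r}" f x] C2 that by (simp add: C2_on_def)
  have der\<phi>: "(?\<phi> has_real_derivative deriv f x) (at x)" if x: "x \<in> {0<..<r}" for x
    by (rule has_field_derivative_transform_within_open[OF der[OF x], of "{0<..<r}"])
       (use x in \<open>auto simp: left_branch_def\<close>)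
  have same: "deriv_on {0..r} ?\<phi> x = deriv f x" if x: "x \<in> {0<..<r}" for x
    using deriv_on_interior[of x "{0..r}" ?\<phi>] DERIV_imp_deriv[OF der\<phi>[OF x]] x by simp
  have der2: "(deriv f has_real_derivative D2 x) (at x)" if "x \<in> {0<..<r}" for x
    using C2_on_has_second_deriv[OF C2, of x] that by (simp add: D2_def)
  have D2: "inverse C * x powr (\<gamma> - 1) \<le> D2 x" "D2 x \<le> C * x powr (\<gamma> - 1)" if x: "x \<in> {0<..<r}" for x
  proof -
    have p: "0 < x powr (\<gamma> - 1)" using x by simp
    show "inverse C * x powr (\<gamma> - 1) \<le> D2 x" "D2 x \<le> C * x powr (\<gamma> - 1)"
      using growth[OF x] by (simp_all only: pos_le_divide_eq[OF p] pos_divide_le_eq[OF p])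
  qed
  have pos: "1 < deriv f x" if x: "x \<in> {0<..<r}" for x
  proof (rule ccontr)
    assume "\<not> 1 < deriv f x"
    then have neg: "deriv f x < -1" using gt1[of x] same[OF x] x by auto
    have "continuous_on {0..<r} (deriv_on {0..<r} f)" using C1 by (simp add: C1_on_def)
    then obtain \<delta> where \<delta>: "0 < \<delta>"
      "\<And>y. y \<in> {0..<r} \<Longrightarrow> dist y 0 < \<delta> \<Longrightarrow> dist (deriv_on {0..<r} f y) (deriv_on {0..<r} f 0) < 1"
      using r unfolding continuous_on_iff by (metis atLeastLessThan_iff order_refl zero_less_one)
    define y where "y = min (\<delta> / 2) (x / 2)"
    have y: "0 < y" "y < x" "y < \<delta>" using \<delta>(1) x by (auto simp: y_def)
    then have "dist (deriv f y) 1 < 1"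
      using \<delta>(2)[of y] deriv_on_interior[of y "{0..<r}" f] d0 x by simp
    then have "0 < deriv f y" by (simp add: dist_real_def)
    moreover have "deriv f y \<le> deriv f x"
    proof (rule DERIV_nonneg_imp_nondecreasing[of y x "deriv f"])
      fix z assume z: "y \<le> z" "z \<le> x"
      then have "0 < inverse C * z powr (\<gamma> - 1)" using C y by simp
      then have "0 \<le> D2 z" using D2(1)[of z] z y x by auto
      then show "\<exists>D. DERIV (deriv f) z :> D \<and> 0 \<le> D" using der2[of z] z y x by auto
    qed (use y in simp)
    ultimately show False using neg by simp
  qed
  have le: "deriv f x \<le> \<Lambda>" if x: "x \<in> {0<..<r}" for x
    using \<Lambda>[of x] same[OF x] x by auto
  show thesis using that[OF C cont der\<phi> pos le der2 D2] .
qed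

text \<open>
  The bound on \<open>f''\<close> makes \<open>f'\<close> Lipschitz. Uniform expansion holds by compactness away from \<open>r\<close>. Near \<open>r\<close> the
  difference quotients at \<open>r\<close> exceed \<open>1\<close> in absolute value since the one-sided derivative does; they are values of
  \<open>f'\<close> at intermediate points, from which \<open>f'\<close> differs little by the Lipschitz bound.
\<close>

lemma right_branch_regular:
  assumes mp: "manneville_pomeau f r"
  obtains \<rho> L where "1 < \<rho>" and "0 \<le> L" and "continuous_on {r..1} (right_branch f r)"
    and "\<And>x. x \<in> {r<..<1} \<Longrightarrow> (right_branch f r has_real_derivative deriv f x) (at x)"
    and "\<And>x. x \<in> {r<..<1} \<Longrightarrow> \<rho> \<le> \<bar>deriv f x\<bar>"
    and "\<And>x y. x \<in> {r<..<1} \<Longrightarrow> y \<in> {r<..<1} \<Longrightarrow> \<bar>deriv f x - deriv f y\<bar> \<le> L * \<bar>x - y\<bar>"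
proof -
  let ?\<phi> = "right_branch f r" and ?D = "deriv_on {r<..1} f"
  have r: "0 < r" "r < 1" and C2: "C2_on {r<..1} f"
    and dr: "?\<phi> differentiable (at r within {r..1})"
    and gt1: "\<And>x. x \<in> {r..1} \<Longrightarrow> 1 < \<bar>deriv_on {r..1} ?\<phi> x\<bar>"
    and bdd: "bdd_above ((\<lambda>x. \<bar>deriv_on {r<..1} ?D x\<bar>) ` {r<..1})"
    using mp by (auto simp: manneville_pomeau_def)
  have C1: "C1_on {r<..1} f" using C2 by (simp add: C2_on_def)
  obtain L0 where L0: "\<And>x. x \<in> {r<..1} \<Longrightarrow> \<bar>deriv_on {r<..1} ?D x\<bar> \<le> L0"
    using bdd unfolding bdd_above_def by (meson imageI)
  have L0_nn: "0 \<le> L0" using L0[of 1] r by auto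
  have filter_eq: "at x within {r..1} = at x within {r<..1}" if "x \<in> {r<..1}" for x
    using that by (intro at_within_nhd[of x "{r<..}"]) auto
  have cont: "continuous_on {r..1} ?\<phi>"
    unfolding continuous_on_eq_continuous_within
  proof
    fix x assume x: "x \<in> {r..1}"
    show "continuous (at x within {r..1}) ?\<phi>"
    proof (cases "x = r")
      case True
      then show ?thesis using differentiable_imp_continuous_within[OF dr] by simp
    next
      case False
      then have x: "x \<in> {r<..1}" using x by auto
      have "f differentiable (at x within {r<..1})" using C1 x by (simp add: C1_on_def)
      then have "continuous (at x within {r<..1}) f" by (rule differentiable_imp_continuous_within)
      then have "continuous (at x within {r<..1}) ?\<phi>"
        by (rule continuous_transform_within[where \<delta> = 1]) (use x in \<open>auto simp: right_branch_def\<close>)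
      then show ?thesis using filter_eq[OF x] by simp
    qed
  qed
  have der: "(f has_real_derivative deriv f x) (at x)" if "x \<in> {r<..<1}" for x
    using C1_on_has_deriv[OF C1, of x] that by simp
  have der\<phi>: "(?\<phi> has_real_derivative deriv f x) (at x)" if x: "x \<in> {r<..<1}" for x
    by (rule has_field_derivative_transform_within_open[OF der[OF x], of "{r<..<1}"])
       (use x in \<open>auto simp: right_branch_def\<close>)
  have der2: "(deriv f has_real_derivative deriv_on {r<..1} ?D x) (at x)" if "x \<in> {r<..<1}" for x
    using C2_on_has_second_deriv[OF C2, of x] that by simp
  have D_eq: "?D x = deriv f x" if "x \<in> {r<..<1}" for x
    using deriv_on_interior[of x "{r<..1}" f] that by simp
  have same: "deriv_on {r..1} ?\<phi> x = ?D x" if x: "x \<in> {r<..1}" for x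
    unfolding deriv_on_def filter_eq[OF x] using x
    by (intro vector_derivative_cong_eq always_eventually) (auto simp: right_branch_def)
  have lip: "\<bar>deriv f x - deriv f y\<bar> \<le> L0 * \<bar>x - y\<bar>" if xy: "x \<in> {r<..<1}" "y \<in> {r<..<1}" for x y
  proof (cases "x = y")
    case False
    let ?l = "min x y" and ?u = "max x y"
    have sub: "{?l..?u} \<subseteq> {r<..<1}" using xy by auto
    have "continuous_on {?l..?u} (deriv f)"
      using sub by (auto intro!: DERIV_continuous_on[of _ _ "deriv_on {r<..1} ?D"]
          has_field_derivative_at_within der2)
    then have "\<exists>t\<in>{?l<..<?u}. \<bar>deriv f x - deriv f y\<bar> = \<bar>deriv_on {r<..1} ?D t\<bar> * \<bar>x - y\<bar>"
      using False xy by (intro mean_value_abs der2) auto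
    then obtain t where t: "t \<in> {?l<..<?u}"
      "\<bar>deriv f x - deriv f y\<bar> = \<bar>deriv_on {r<..1} ?D t\<bar> * \<bar>x - y\<bar>" by blast
    moreover have "t \<in> {r<..1}" using t(1) xy by auto
    ultimately show ?thesis using L0[of t] by (auto intro!: mult_right_mono)
  qed simp

  define d where "d = deriv_on {r..1} ?\<phi> r"
  have d: "1 < \<bar>d\<bar>" using gt1[of r] r by (simp add: d_def)
  have "(?\<phi> has_real_derivative d) (at r within {r..1})"
    using dr unfolding d_def deriv_on_def
    by (simp add: has_real_derivative_iff_has_vector_derivative vector_derivative_works)
  then have "((\<lambda>y. (?\<phi> y - ?\<phi> r) / (y - r)) \<longlongrightarrow> d) (at r within {r..1})"
    by (simp add: has_field_derivative_iff)
  then have lim: "((\<lambda>y. \<bar>(?\<phi> y - ?\<phi> r) / (y - r)\<bar>) \<longlongrightarrow> \<bar>d\<bar>) (at r within {r..1})"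
    by (rule tendsto_rabs)
  define e where "e = (\<bar>d\<bar> - 1) / 4"
  have e: "0 < e" "\<bar>d\<bar> = 1 + 4 * e" using d by (simp_all add: e_def field_simps)
  have "\<forall>\<^sub>F y in at r within {r..1}. 1 + 2 * e < \<bar>(?\<phi> y - ?\<phi> r) / (y - r)\<bar>"
    using lim e by (intro order_tendstoD(1)) auto
  then obtain \<delta> where \<delta>: "0 < \<delta>"
    "\<And>y. y \<in> {r..1} \<Longrightarrow> y \<noteq> r \<Longrightarrow> dist y r < \<delta> \<Longrightarrow> 1 + 2 * e < \<bar>(?\<phi> y - ?\<phi> r) / (y - r)\<bar>"
    unfolding eventually_at by blast
  define \<epsilon> where "\<epsilon> = min (\<delta> / 2) (min (e / (L0 + 1)) ((1 - r) / 2))"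
  have \<epsilon>: "0 < \<epsilon>" "\<epsilon> < \<delta>" "r + \<epsilon> < 1" "L0 * \<epsilon> \<le> e"
  proof -
    have "\<epsilon> \<le> \<delta> / 2" "\<epsilon> \<le> (1 - r) / 2" unfolding \<epsilon>_def by linarith+
    then show "\<epsilon> < \<delta>" "r + \<epsilon> < 1" using \<delta>(1) r by auto
    show "0 < \<epsilon>" using \<delta>(1) e(1) L0_nn r by (simp add: \<epsilon>_def)
    have "L0 * \<epsilon> \<le> (L0 + 1) * (e / (L0 + 1))"
      using L0_nn \<open>0 < \<epsilon>\<close> by (intro mult_mono) (auto simp: \<epsilon>_def)
    then show "L0 * \<epsilon> \<le> e" using L0_nn by simp
  qed
  have near: "1 + e \<le> \<bar>deriv f x\<bar>" if x: "r < x" "x \<le> r + \<epsilon>" for x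
  proof -
    have "continuous_on {r..x} ?\<phi>" using cont x \<epsilon> by (auto intro: continuous_on_subset)
    then obtain t where t: "r < t" "t < x" "?\<phi> x - ?\<phi> r = deriv f t * (x - r)"
      using mean_value[OF x(1), of ?\<phi> "deriv f"] der\<phi> x \<epsilon> by auto
    then have "1 + 2 * e < \<bar>deriv f t\<bar>" using \<delta>(2)[of x] x \<epsilon> by (auto simp: dist_real_def)
    moreover have "\<bar>deriv f t - deriv f x\<bar> \<le> L0 * \<bar>t - x\<bar>" using t x \<epsilon> by (intro lip) auto
    moreover have "L0 * \<bar>t - x\<bar> \<le> L0 * \<epsilon>" using L0_nn t x by (intro mult_left_mono) auto
    ultimately show ?thesis using \<epsilon>(4) by linarith
  qed
  have "continuous_on {r<..1} ?D" using C1 unfolding C1_on_def by blast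
  then have "continuous_on {r + \<epsilon>..1} ?D"
    by (rule continuous_on_subset) (use \<epsilon>(1) in auto)
  then have "continuous_on {r + \<epsilon>..1} (\<lambda>x. \<bar>?D x\<bar>)" by (rule continuous_on_rabs)
  then obtain x0 where x0: "x0 \<in> {r + \<epsilon>..1}" "\<And>x. x \<in> {r + \<epsilon>..1} \<Longrightarrow> \<bar>?D x0\<bar> \<le> \<bar>?D x\<bar>"
    using continuous_attains_inf[of "{r + \<epsilon>..1}" "\<lambda>x. \<bar>?D x\<bar>"] \<epsilon> by auto
  define \<rho> where "\<rho> = min (1 + e) \<bar>?D x0\<bar>"
  have "1 < \<rho>" using gt1[of x0] same[of x0] x0(1) \<epsilon> e by (auto simp: \<rho>_def)
  moreover have "\<rho> \<le> \<bar>deriv f x\<bar>" if "x \<in> {r<..<1}" for x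
    using near[of x] x0(2)[of x] D_eq[of x] that by (cases "x \<le> r + \<epsilon>") (auto simp: \<rho>_def)
  ultimately show thesis using that[OF _ L0_nn cont der\<phi> _ lip] by blast
qed

section \<open>Coding of the induced map\<close>

text \<open>
  An orbit that stays in \<open>(0, r)\<close> increases to a fixed point in \<open>(0, r]\<close>, but by the mean value theorem the
  branch lies above the diagonal there.
\<close>

lemma expanding_branch_exits:
  fixes \<phi> \<phi>' :: "real \<Rightarrow> real"
  assumes r: "0 < r" and cont: "continuous_on {0..r} \<phi>" and zero: "\<phi> 0 = 0"
    and der: "\<And>x. x \<in> {0<..<r} \<Longrightarrow> (\<phi> has_real_derivative \<phi>' x) (at x)"
    and gt: "\<And>x. x \<in> {0<..<r} \<Longrightarrow> 1 < \<phi>' x"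
  shows "\<exists>n. (\<phi> ^^ n) y \<notin> {0<..<r}"
proof (rule ccontr)
  assume "\<nexists>n. (\<phi> ^^ n) y \<notin> {0<..<r}"
  then have stay: "(\<phi> ^^ n) y \<in> {0<..<r}" for n by blast
  have above: "x < \<phi> x" if x: "0 < x" "x \<le> r" for x
  proof -
    have "continuous_on {0..x} \<phi>" using cont x by (auto intro: continuous_on_subset)
    then obtain t where t: "0 < t" "t < x" "\<phi> x - \<phi> 0 = \<phi>' t * (x - 0)"
      using mean_value[OF x(1), of \<phi> \<phi>'] der x by auto
    then have "1 * x < \<phi>' t * x" using gt[of t] x by (intro mult_strict_right_mono) auto
    then show ?thesis using t zero by simp
  qed
  let ?u = "\<lambda>n. (\<phi> ^^ n) y"
  have u: "0 < ?u n" "?u n \<le> r" "?u n \<in> {0..r}" for n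
    using stay[of n] by auto
  have inc: "incseq ?u"
    using above[OF u(1,2)] by (intro incseq_SucI) (simp add: less_imp_le)
  obtain l where l: "?u \<longlonglongrightarrow> l" "\<forall>n. ?u n \<le> l"
    using incseq_convergent[OF inc, of r] u(2) by blast
  have "l \<le> r" using l(1) u(2) by (intro LIMSEQ_le_const2) auto
  moreover have "0 < l" using l(2) u(1) less_le_trans by blast
  ultimately have "l < \<phi> l" by (intro above)
  have "(\<lambda>n. \<phi> (?u n)) \<longlonglongrightarrow> \<phi> l"
    using \<open>l \<le> r\<close> \<open>0 < l\<close> u(3)
    by (intro continuous_on_tendsto_compose[OF cont l(1)] always_eventually) auto
  moreover have "(\<lambda>n. \<phi> (?u n)) \<longlonglongrightarrow> l" using LIMSEQ_Suc[OF l(1)] by simp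
  ultimately have "\<phi> l = l" by (rule LIMSEQ_unique)
  then show False using \<open>l < \<phi> l\<close> by simp
qed

lemma induced_map_eq:
  assumes "induced_map f r F" "t \<in> {r..1}" "(f ^^ Suc n) t \<in> {r..1}"
    and "\<And>i. i < n \<Longrightarrow> (f ^^ Suc i) t \<notin> {r..1}"
  shows "F t = (f ^^ Suc n) t"
proof -
  have "return_time f r t = enat (Suc n)"
    unfolding return_time_def
  proof (rule antisym)
    show "Inf {enat n |n. 1 \<le> n \<and> (f ^^ n) t \<in> {r..1}} \<le> enat (Suc n)"
      using assms(3) by (intro Inf_lower) (auto simp del: funpow.simps)
    show "enat (Suc n) \<le> Inf {enat n |n. 1 \<le> n \<and> (f ^^ n) t \<in> {r..1}}"
    proof (rule Inf_greatest)
      fix z assume "z \<in> {enat n |n. 1 \<le> n \<and> (f ^^ n) t \<in> {r..1}}"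
      then obtain k where k: "z = enat k" "1 \<le> k" "(f ^^ k) t \<in> {r..1}" by blast
      have "\<not> k - 1 < n" using assms(4)[of "k - 1"] k by auto
      then show "enat (Suc n) \<le> z" using k by simp
    qed
  qed
  moreover have "case return_time f r t of enat n \<Rightarrow> F t = (f ^^ n) t | \<infinity> \<Rightarrow> F t \<in> {r, 1}"
    using assms(1,2) unfolding induced_map_def by blast
  ultimately show ?thesis by (simp del: funpow.simps)
qed

text \<open>
  With \<open>h\<close> and \<open>k\<close> the inverses of the left and the right branch, the inverse branches of \<open>F\<close> are \<open>k \<circ> h ^^ i\<close>, one for
  each number \<open>i\<close> of steps that a point of \<open>(r, 1)\<close> spends in \<open>(0, r)\<close> before it returns. The end points \<open>r\<close> and \<open>1\<close> are
  excluded: their return time may be infinite, and then \<open>F\<close> is arbitrary.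
\<close>

lemma induced_map_coding:
  assumes mp: "manneville_pomeau f r" and ind: "induced_map f r F"
  obtains g g' \<mu> L where "markov_contractions r 1 g g' \<mu> L"
    and "\<And>t. t \<in> {r<..<1} \<Longrightarrow> F t \<in> {r..1} \<and> (\<exists>i. t = g i (F t))"
proof -
  let ?\<phi> = "left_branch f r" and ?\<psi> = "right_branch f r"
    and ?D2 = "deriv_on {0<..<r} (deriv_on {0<..<r} f)"
  have r: "0 < r" "r < 1" and onto: "f ` {0<..<r} = {0<..<1}" "f ` {r<..<1} = {0<..<1}" and f0: "f 0 = 0"
    using mp by (auto simp: manneville_pomeau_def)
  obtain \<Lambda> C \<gamma> where C: "1 \<le> C" and lcont: "continuous_on {0..r} ?\<phi>"
    and lder: "\<And>x. x \<in> {0<..<r} \<Longrightarrow> (?\<phi> has_real_derivative deriv f x) (at x)"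
    and lgt: "\<And>x. x \<in> {0<..<r} \<Longrightarrow> 1 < deriv f x" and lle: "\<And>x. x \<in> {0<..<r} \<Longrightarrow> deriv f x \<le> \<Lambda>"
    and lder2: "\<And>x. x \<in> {0<..<r} \<Longrightarrow> (deriv f has_real_derivative ?D2 x) (at x)"
    and lge2: "\<And>x. x \<in> {0<..<r} \<Longrightarrow> inverse C * x powr (\<gamma> - 1) \<le> ?D2 x"
    and lle2: "\<And>x. x \<in> {0<..<r} \<Longrightarrow> ?D2 x \<le> C * x powr (\<gamma> - 1)"
    by (rule left_branch_regular[OF mp]) (rule that)
  obtain \<rho> L1 where \<rho>: "1 < \<rho>" and L1: "0 \<le> L1" and rcont: "continuous_on {r..1} ?\<psi>"
    and rder: "\<And>x. x \<in> {r<..<1} \<Longrightarrow> (?\<psi> has_real_derivative deriv f x) (at x)"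
    and rge: "\<And>x. x \<in> {r<..<1} \<Longrightarrow> \<rho> \<le> \<bar>deriv f x\<bar>"
    and rlip: "\<And>x y. x \<in> {r<..<1} \<Longrightarrow> y \<in> {r<..<1} \<Longrightarrow> \<bar>deriv f x - deriv f y\<bar> \<le> L1 * \<bar>x - y\<bar>"
    by (rule right_branch_regular[OF mp]) (rule that)
  have lonto: "?\<phi> ` {0<..<r} = {0<..<1}" and ronto: "?\<psi> ` {r<..<1} = {0<..<1}"
    using onto by (auto simp: left_branch_def right_branch_def image_def)
  obtain h where h: "continuous_on {0..1} h"
    "\<And>x. x \<in> {0..r} \<Longrightarrow> h (?\<phi> x) = x"
    "\<And>y. y \<in> {0..1} \<Longrightarrow> h y \<in> {0..r} \<and> ?\<phi> (h y) = y"
    "\<And>y. y \<in> {0<..<1} \<Longrightarrow> h y \<in> {0<..<r} \<and> (h has_real_derivative inverse (deriv f (h y))) (at y)"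
  proof (rule branch_inverse[OF r(1) lcont lder _ lonto])
    show "deriv f x \<noteq> 0" if "x \<in> {0<..<r}" for x using lgt[OF that] by auto
  qed (assumption | rule that)+
  obtain k where k: "continuous_on {0..1} k"
    "\<And>x. x \<in> {r..1} \<Longrightarrow> k (?\<psi> x) = x"
    "\<And>y. y \<in> {0..1} \<Longrightarrow> k y \<in> {r..1} \<and> ?\<psi> (k y) = y"
    "\<And>y. y \<in> {0<..<1} \<Longrightarrow> k y \<in> {r<..<1} \<and> (k has_real_derivative inverse (deriv f (k y))) (at y)"
  proof (rule branch_inverse[OF r(2) rcont rder _ ronto])
    show "deriv f x \<noteq> 0" if "x \<in> {r<..<1}" for x using rge[OF that] \<rho> by auto
  qed (assumption | rule that)+
  have l0: "?\<phi> 0 = 0" using r f0 by (simp add: left_branch_def)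

  interpret neutral_inverse_branch h "deriv f" ?D2 r \<Lambda> C \<gamma>
  proof
    fix y :: real assume y: "y \<in> {0<..<1}"
    then have hy: "0 < h y" "h y < r" using h(4) by auto
    have "continuous_on {0..h y} ?\<phi>" using lcont hy by (auto intro: continuous_on_subset)
    then obtain t where t: "0 < t" "t < h y" "?\<phi> (h y) - ?\<phi> 0 = deriv f t * (h y - 0)"
      using mean_value[OF hy(1), of ?\<phi> "deriv f"] lder hy by auto
    then have "y = deriv f t * h y" using h(3)[of y] l0 y by simp
    also have "\<dots> \<le> \<Lambda> * h y" using lle[of t] t hy by (intro mult_right_mono) auto
    finally show "y \<le> \<Lambda> * h y" .
  qed (use r C h(4) lgt lle lder2 lge2 lle2 in blast)+

  obtain L0 where L0: "0 \<le> L0" "\<And>n x y. x \<in> {r<..<1} \<Longrightarrow> y \<in> {r<..<1} \<Longrightarrow>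
      iter_deriv n x \<le> exp (L0 * \<bar>x - y\<bar>) * iter_deriv n y"
    using iter_deriv_distortion by blast
  have unit: "x \<in> {0<..<1}" if "x \<in> {r<..<1}" for x using that r by auto
  define g where "g i x = k ((h ^^ i) x)" for i x
  define g' where "g' i x = inverse (deriv f (g i x)) * iter_deriv i x" for i x
  have iter_closed: "(h ^^ i) x \<in> {0..1}" if "x \<in> {0..1}" for i x
  proof (induction i)
    case (Suc i) then show ?case using h(3)[of "(h ^^ i) x"] r by auto
  qed (use that in simp)
  have g_open: "g i x \<in> {r<..<1}" if "x \<in> {r<..<1}" for i x
    unfolding g_def using k(4) iter_in[OF unit[OF that]] by blast
  have g_nz: "\<rho> \<le> \<bar>deriv f (g i x)\<bar>" if "x \<in> {r<..<1}" for i x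
    using rge g_open that by blast

  have g_cont: "continuous_on {r..1} (g i)" for i
  proof -
    have "continuous_on {0..1} (h ^^ i)"
    proof (induction i)
      case (Suc i)
      have "continuous_on {0..1} (\<lambda>x. h ((h ^^ i) x))"
        by (intro continuous_on_compose2[OF h(1) Suc.IH] image_subsetI iter_closed)
      then show ?case by (simp add: o_def)
    qed (simp add: id_def)
    then have "continuous_on {0..1} (g i)"
      unfolding g_def by (rule continuous_on_compose2[OF k(1)]) (intro image_subsetI iter_closed)
    then show ?thesis by (rule continuous_on_subset) (use r in auto)
  qed
  have g_deriv: "(g i has_real_derivative g' i x) (at x)" if x: "x \<in> {r<..<1}" for i x
  proof -
    have "(k has_real_derivative inverse (deriv f (g i x))) (at ((h ^^ i) x))"
      unfolding g_def using k(4) iter_in[OF unit[OF x]] by blast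
    from DERIV_chain2[OF this iter_has_deriv[OF unit[OF x]]]
    show ?thesis unfolding g'_def g_def .
  qed
  have g_contr: "\<bar>g' i x\<bar> \<le> 1 / \<rho>" if x: "x \<in> {r<..<1}" for i x
  proof -
    have "\<bar>g' i x\<bar> \<le> inverse \<bar>deriv f (g i x)\<bar> * 1"
      unfolding g'_def abs_mult using iter_deriv_bounds[OF unit[OF x], of i]
      by (intro mult_mono) auto
    also have "\<dots> \<le> 1 / \<rho>"
      using g_nz[OF x, of i] \<rho> by (simp add: inverse_eq_divide frac_le)
    finally show ?thesis .
  qed
  have g_lip: "\<bar>g i x - g i y\<bar> \<le> \<bar>x - y\<bar>" if x: "x \<in> {r<..<1}" and y: "y \<in> {r<..<1}" for i x y
  proof (cases "x = y")
    case False
    have "\<exists>t\<in>{r<..<1}. \<bar>g i x - g i y\<bar> = \<bar>g' i t\<bar> * \<bar>x - y\<bar>"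
      using x y False by (intro mean_value_abs g_cont g_deriv) auto
    then obtain t where t: "t \<in> {r<..<1}" "\<bar>g i x - g i y\<bar> = \<bar>g' i t\<bar> * \<bar>x - y\<bar>" by blast
    have "1 / \<rho> \<le> 1" using \<rho> by simp
    then have "\<bar>g' i t\<bar> \<le> 1" using g_contr[OF t(1), of i] by linarith
    then show ?thesis unfolding t(2) using mult_right_mono[of "\<bar>g' i t\<bar>" 1 "\<bar>x - y\<bar>"] by simp
  qed simp

  have mc: "markov_contractions r 1 g g' (1 / \<rho>) (L1 + L0)"
  proof
    show "r < 1" "0 < 1 / \<rho>" "1 / \<rho> < 1" "0 \<le> L1 + L0" using r \<rho> L1 L0 by auto
    show "continuous_on {r..1} (g i)" for i by (rule g_cont)
    show "g i x \<in> {r..1}" if "x \<in> {r..1}" for i x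
      unfolding g_def using k(3) iter_closed[of x i] that r by auto
    show "g i x \<in> {r<..<1}" if "x \<in> {r<..<1}" for i x by (rule g_open[OF that])
    \<comment> \<open>After cancelling \<open>h ^^ i\<close>, a point of \<open>(r, 1)\<close> would coincide with a point of \<open>h ((0, 1)) = (0, r)\<close>.\<close>
    have no_overlap: "\<not> i < j" if xy: "x \<in> {r<..<1}" "y \<in> {r<..<1}" "g i x = g j y" for i j x y
    proof
      assume "i < j"
      then obtain d where d: "j = i + Suc d" using less_imp_Suc_add by auto
      have "?\<psi> (g i x) = (h ^^ i) x" "?\<psi> (g j y) = (h ^^ j) y"
        unfolding g_def using k(3) iter_in unit xy(1,2) by (auto simp: less_imp_le)
      then have "(h ^^ i) x = (h ^^ i) ((h ^^ Suc d) y)"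
        using xy(3) unfolding d by (metis comp_apply funpow_add)
      moreover have "(h ^^ Suc d) y \<in> {0<..<r}" using iter_Suc_in unit xy(2) by blast
      then have "(h ^^ i) ((h ^^ Suc d) y) < (h ^^ i) x"
        using xy(1) r by (intro iter_strict_mono) auto
      ultimately show False by simp
    qed
    show "i = j" if "x \<in> {r<..<1}" "y \<in> {r<..<1}" "g i x = g j y" for i j x y
      using no_overlap[of x y i j] no_overlap[of y x j i] that by (metis linorder_neqE_nat)
    show "(g i has_real_derivative g' i x) (at x)" if x: "x \<in> {r<..<1}" for i x by (rule g_deriv[OF x])
    show "g' i x \<noteq> 0" if x: "x \<in> {r<..<1}" for i x
      using g_nz[OF x, of i] \<rho> iter_deriv_bounds(1)[OF unit[OF x], of i] by (auto simp: g'_def)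
    show "\<bar>g' i x\<bar> \<le> 1 / \<rho>" if x: "x \<in> {r<..<1}" for i x by (rule g_contr[OF x])
    show "\<bar>g' i x\<bar> \<le> exp ((L1 + L0) * \<bar>x - y\<bar>) * \<bar>g' i y\<bar>"
      if x: "x \<in> {r<..<1}" and y: "y \<in> {r<..<1}" for i x y
    proof -
      let ?p = "deriv f (g i x)" and ?q = "deriv f (g i y)"
      have pq: "1 < \<bar>?p\<bar>" "1 < \<bar>?q\<bar>" using g_nz[OF x, of i] g_nz[OF y, of i] \<rho> by auto
      have "\<bar>?q\<bar> \<le> \<bar>?p\<bar> + L1 * \<bar>x - y\<bar>"
        using rlip[OF g_open[OF x] g_open[OF y], of i i] mult_left_mono[OF g_lip[OF x y, of i] L1] by linarith
      also have "\<dots> \<le> \<bar>?p\<bar> * (1 + L1 * \<bar>x - y\<bar>)"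
        using mult_right_mono[of 1 "\<bar>?p\<bar>" "L1 * \<bar>x - y\<bar>"] pq L1 by (simp add: distrib_left)
      also have "\<dots> \<le> \<bar>?p\<bar> * exp (L1 * \<bar>x - y\<bar>)"
        by (intro mult_left_mono exp_ge_add_one_self) auto
      finally have "inverse \<bar>?p\<bar> \<le> exp (L1 * \<bar>x - y\<bar>) * inverse \<bar>?q\<bar>"
        using pq by (simp add: field_simps)
      then have "\<bar>g' i x\<bar> \<le> (exp (L1 * \<bar>x - y\<bar>) * inverse \<bar>?q\<bar>) * (exp (L0 * \<bar>x - y\<bar>) * iter_deriv i y)"
        unfolding g'_def abs_mult using L0(2)[OF x y, of i] iter_deriv_bounds(1)[OF unit[OF x], of i]
        by (intro mult_mono) auto
      also have "\<dots> = exp ((L1 + L0) * \<bar>x - y\<bar>) * \<bar>g' i y\<bar>"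
        using iter_deriv_bounds(1)[OF unit[OF y], of i]
        by (simp add: g'_def abs_mult distrib_right exp_add)
      finally show ?thesis .
    qed
  qed

  have coding: "F t \<in> {r..1} \<and> (\<exists>i. t = g i (F t))" if t: "t \<in> {r<..<1}" for t
  proof -
    define y where "y = f t"
    have y: "y \<in> {0<..<1}" using onto(2) t by (auto simp: y_def)
    have ty: "k y = t" using k(2)[of t] t by (auto simp: right_branch_def y_def)
    obtain n0 where "(?\<phi> ^^ n0) y \<notin> {0<..<r}"
      using expanding_branch_exits[OF r(1) lcont l0 lder lgt] by blast
    define n where "n = (LEAST n. (?\<phi> ^^ n) y \<notin> {0<..<r})"
    have n: "(?\<phi> ^^ n) y \<notin> {0<..<r}"
      unfolding n_def by (rule LeastI) fact
    have before: "(?\<phi> ^^ i) y \<in> {0<..<r}" if "i < n" for i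
      using not_less_Least[of i "\<lambda>n. (?\<phi> ^^ n) y \<notin> {0<..<r}"] that unfolding n_def by blast
    have eq: "(f ^^ i) y = (?\<phi> ^^ i) y \<and> (?\<phi> ^^ i) y \<in> {0<..<1} \<and> (h ^^ i) ((?\<phi> ^^ i) y) = y" if "i \<le> n" for i
      using that
    proof (induction i)
      case (Suc i)
      let ?z = "(?\<phi> ^^ i) y"
      have z: "?z \<in> {0<..<r}" using before Suc.prems by simp
      have hz: "h (?\<phi> ?z) = ?z" by (rule h(2)) (use z in auto)
      have fz: "?\<phi> ?z = f ?z" using z by (auto simp: left_branch_def)
      have "f ?z \<in> {0<..<1}" using onto(1) z by blast
      moreover have "(f ^^ i) y = ?z" "(h ^^ i) ?z = y" using Suc by auto
      moreover have "(h ^^ Suc i) (?\<phi> ?z) = (h ^^ i) (h (?\<phi> ?z))" by (simp only: funpow_Suc_right comp_apply)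
      ultimately show ?case using hz fz by simp
    qed (use y in simp)
    have Fn: "(f ^^ n) y \<in> {r..<1}" using eq[of n] n by auto
    have "F t = (f ^^ Suc n) t"
    proof (rule induced_map_eq[OF ind])
      show "t \<in> {r..1}" using t by auto
      show "(f ^^ Suc n) t \<in> {r..1}" using Fn by (auto simp: funpow_swap1 y_def)
      show "(f ^^ Suc i) t \<notin> {r..1}" if "i < n" for i
        using before[OF that] eq[of i] that by (auto simp: funpow_swap1 y_def)
    qed
    then have "F t = (f ^^ n) y" by (simp add: funpow_swap1 y_def)
    then show ?thesis using Fn eq[of n] ty by (auto simp: g_def intro!: exI[of _ n])
  qed
  show thesis using that[OF mc coding] .
qed

text \<open>
  Avoiding neighbourhoods of \<open>r\<close> and \<open>1\<close> keeps the orbit in \<open>(r, 1)\<close>, where \<open>F\<close> is given by its branches; so every point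
  of the orbit is reached from \<open>x\<close> by inverting a word.
\<close>

theorem theorem1p3:
  fixes f F :: "real \<Rightarrow> real" and r\<^sub>1 :: real and Q :: "real set"
  assumes "manneville_pomeau f r\<^sub>1"
    and "induced_map f r\<^sub>1 F"
    and "countable Q" and "Q \<subseteq> {r\<^sub>1..1}"
  shows "absolute_winning {r\<^sub>1..1} (exceptional_set {r\<^sub>1..1} F Q)"
proof -
  have r: "r\<^sub>1 < 1" using assms(1) by (simp add: manneville_pomeau_def)
  obtain g g' \<mu> L where mc: "markov_contractions r\<^sub>1 1 g g' \<mu> L"
    and coding: "\<And>t. t \<in> {r\<^sub>1<..<1} \<Longrightarrow> F t \<in> {r\<^sub>1..1} \<and> (\<exists>i. t = g i (F t))"
    by (rule induced_map_coding[OF assms(1,2)]) (rule that)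
  interpret markov_contractions r\<^sub>1 1 g g' \<mu> L by (rule mc)
  define q where "q = from_nat_into (insert r\<^sub>1 (insert 1 Q))"
  have q: "range q = insert r\<^sub>1 (insert 1 Q)"
    unfolding q_def using assms(3) by (intro range_from_nat_into) auto
  have "beta_absolute_winning \<beta> {r\<^sub>1..1} (exceptional_set {r\<^sub>1..1} F Q)" if \<beta>: "0 < \<beta>" "\<beta> < 1 / 3" for \<beta>
  proof (rule avoiding_points_winning[where q = q])
    fix x assume x: "x \<in> {r\<^sub>1..1}"
      and avoid: "\<And>j. \<exists>\<delta>>0. \<forall>w. \<forall>t\<in>{r\<^sub>1..1}. x = word w t \<longrightarrow> \<delta> \<le> \<bar>t - q j\<bar>"
    have far: "t \<noteq> p" if xt: "x = word w t" "t \<in> {r\<^sub>1..1}" and p: "p \<in> {r\<^sub>1, 1}" for w t p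
    proof -
      have "p \<in> range q" using q p by blast
      then obtain j where "p = q j" by blast
      with avoid[of j] xt show ?thesis by force
    qed
    have orbit: "(F ^^ n) x \<in> {r\<^sub>1..1} \<and> (\<exists>w. x = word w ((F ^^ n) x))" for n
    proof (induction n)
      case 0
      then show ?case using x by (auto intro!: exI[of _ "[]"])
    next
      case (Suc n)
      then obtain w where w: "x = word w ((F ^^ n) x)" and t: "(F ^^ n) x \<in> {r\<^sub>1..1}" by blast
      have "(F ^^ n) x \<in> {r\<^sub>1<..<1}" using far[OF w t] t by force
      from coding[OF this] obtain i where i: "F ((F ^^ n) x) \<in> {r\<^sub>1..1}" "(F ^^ n) x = g i (F ((F ^^ n) x))"
        by blast
      then have "x = word (w @ [i]) ((F ^^ Suc n) x)" using w by (simp add: word_append)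
      with i show ?case by auto
    qed
    show "x \<in> exceptional_set {r\<^sub>1..1} F Q"
      unfolding exceptional_set_def
    proof (intro CollectI conjI x equals0I)
      fix p assume "p \<in> Q \<inter> closure {(F ^^ n) x |n. n \<ge> 0}"
      then have "p \<in> Q" and p: "p \<in> closure {(F ^^ n) x |n. n \<ge> 0}" by auto
      then obtain j where "q j = p" using q by (metis insertCI imageE)
      with avoid[of j] obtain \<delta> where \<delta>: "0 < \<delta>"
        "\<And>w t. t \<in> {r\<^sub>1..1} \<Longrightarrow> x = word w t \<Longrightarrow> \<delta> \<le> \<bar>t - p\<bar>" by blast
      from p \<delta>(1) obtain z where "z \<in> {(F ^^ n) x |n. n \<ge> 0}" "dist z p < \<delta>"
        unfolding closure_approachable by blast
      then obtain n where "\<bar>(F ^^ n) x - p\<bar> < \<delta>" by (auto simp: dist_real_def)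
      with \<delta>(2) orbit[of n] show False by force
    qed
  qed (use \<beta> in auto)
  then show ?thesis
    unfolding absolute_winning_def using r by (auto simp: exceptional_set_def)
qed

end
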